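(* Assume the Generalized Riemann Hypothesis for Dirichlet $L$-functions $L(s,\chi)$. Let $\sigma\in(1/2,1)$ be fixed. For every $\theta\in[0,\frac{\pi}{2}]\cup[\frac{3\pi}{2},2\pi]$ there is a positive number $D_{\sigma,\theta}$, depending on $\sigma$ and $\theta$, satisfying \[ D_{\sigma,\theta}<\cos\theta\bigg(\frac{\sigma}{1-\sigma}+o_{\sigma}(1)\bigg)\bigg(\frac{1}{2\sigma}\bigg)^{1-\sigma}, \] such that for all sufficiently large primes $q$, \[ \max_{\substack{\chi\neq\chi_0\\ \chi\bmod q}}\Re\big(e^{-i\theta}\log L(\sigma,\chi)\big)\geq D_{\sigma,\theta}\frac{(\log q)^{1-\sigma}}{(\log\log q)^{\sigma}}. \]
   Context: $L(s,\chi)$ denotes the Dirichlet $L$-function of a Dirichlet character $\chi$ modulo $q$, and $\chi_0$ is the principal character modulo $q$; the maximum is over non-principal characters modulo $q$.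
   Formalization: The two values θ = π/2 and θ = 3π/2 are excluded, since there cos θ = 0 and the requirement on the positive number D would read 0 < D < 0, which is impossible. *)

theory Defs
  imports "HOL-Complex_Analysis.Complex_Analysis" "HOL-Computational_Algebra.Primes"
    "HOL-Library.Landau_Symbols"
begin

definition dirichlet_char :: "nat \<Rightarrow> (nat \<Rightarrow> complex) \<Rightarrow> bool" where
  "dirichlet_char q \<psi> \<longleftrightarrow>
     (\<forall>m n. \<psi> (m * n) = \<psi> m * \<psi> n) \<and>
     (\<forall>n. \<psi> (n + q) = \<psi> n) \<and>
     (\<forall>n. \<psi> n \<noteq> 0 \<longleftrightarrow> coprime n q)"

definition principal_char :: "nat \<Rightarrow> nat \<Rightarrow> complex" where
  "principal_char q n = (if coprime n q then 1 else 0)"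

text \<open>
  The continuation of the Dirichlet series from \<open>Re s > 1\<close> to \<open>Re s > 0\<close>, \<open>s \<noteq> 1\<close>, which
  exists for every Dirichlet character and is unique by the identity theorem. When the character
  is not principal, the singularity at 1 is removable and the series itself converges there;
  to cover this, the continuation is required to be holomorphic at 1 whenever that is possible,
  i.e. whenever the character is not principal. Values at \<open>Re s \<le> 0\<close> are irrelevant and left
  unspecified; for principal characters so is the value at the pole 1.
\<close>
definition dirichlet_L :: "nat \<Rightarrow> (nat \<Rightarrow> complex) \<Rightarrow> complex \<Rightarrow> complex" where
  "dirichlet_L q \<psi> =
     (SOME f. f holomorphic_on {s. Re s > 0 \<and> (\<psi> = principal_char q \<longrightarrow> s \<noteq> 1)} \<and>
        (\<forall>s. Re s > 1 \<longrightarrow> (\<lambda>n. \<psi> (Suc n) / of_nat (Suc n) powr s) sums f s))"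

text \<open>
  All zeros in the open critical strip lie on the critical line. Zeros of imprimitive characters
  on the line \<open>Re s = 0\<close>, which come from the missing Euler factors, are not excluded.
\<close>
definition GRH :: bool where
  "GRH \<longleftrightarrow>
     (\<forall>q>0. \<forall>\<psi> s. dirichlet_char q \<psi> \<longrightarrow> 0 < Re s \<longrightarrow> Re s < 1 \<longrightarrow>
        dirichlet_L q \<psi> s = 0 \<longrightarrow> Re s = 1 / 2)"

text \<open>
  The branch of \<open>log L(s, \<psi>)\<close> on \<open>Re s > 1/2\<close> for a non-principal character, where \<open>L\<close> does not
  vanish under GRH. Vanishing at \<open>+\<infinity>\<close> fixes the multiple of \<open>2\<pi>i\<close>, so that for \<open>Re s > 1\<close> it is
  the logarithm given by the Euler product. It is in general not the principal value of the
  logarithm of \<open>L(s, \<psi>)\<close>.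
\<close>
definition log_dirichlet_L :: "nat \<Rightarrow> (nat \<Rightarrow> complex) \<Rightarrow> complex \<Rightarrow> complex" where
  "log_dirichlet_L q \<psi> =
     (SOME g. g holomorphic_on {s. Re s > 1 / 2} \<and>
        (\<forall>s. Re s > 1 / 2 \<longrightarrow> exp (g s) = dirichlet_L q \<psi> s) \<and>
        ((\<lambda>x::real. g (of_real x)) \<longlongrightarrow> 0) at_top)"

end

theory Submission
  imports Defs "HOL-Number_Theory.Number_Theory" "HOL-Real_Asymp.Real_Asymp"
begin

text \<open>
  Weight the characters modulo \<open>q\<close> by \<open>W(\<psi>) = \<Prod>\<^sub>p\<^sub>\<in>\<^sub>P |1 + \<psi>(p)|\<^sup>2\<close> for a set \<open>P\<close> of about \<open>(log q)/4\<close>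
  primes up to \<open>log q log log q\<close>. Orthogonality makes every sum \<open>\<Sum>\<^sub>\<psi> W(\<psi>) \<psi>(n)\<close> real and
  nonnegative, and at least half of \<open>\<Sum>\<^sub>\<psi> W(\<psi>)\<close> if \<open>n \<in> P\<close>. So if \<open>log L(\<sigma>, \<psi>)\<close> is a combination
  of the \<open>\<psi>(n)\<close> with nonnegative coefficients, about \<open>p\<^sup>-\<^sup>\<sigma>\<close> at the primes \<open>p\<close>, then the weighted
  average of \<open>Re (e\<^sup>-\<^sup>i\<^sup>\<theta> log L(\<sigma>, \<psi>))\<close> is at least \<open>cos \<theta>\<close> times a constant times
  \<open>\<Sum>\<^sub>p\<^sub>\<in>\<^sub>P p\<^sup>-\<^sup>\<sigma>\<close>, which has the required order. Since \<open>W \<le> 4\<^bsup>|P|\<^esup> \<le> q\<^bsup>1/2\<^esup>\<close>, a bounded number of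
  characters may be left out.

  Up to a bounded error such a combination is the Taylor polynomial of \<open>log L\<close> at \<open>3\<close> of
  degree about \<open>log log q\<close>, evaluated at \<open>\<sigma>\<close>: as \<open>\<sigma> < 3\<close>, expanding \<open>n\<^sup>-\<^sup>s\<close> gives nonnegative
  coefficients. Under GRH, \<open>log L\<close> is holomorphic in a disc of radius \<open>5/2\<close>, and Borel-Caratheodory
  bounds its Taylor coefficients. As GRH is silent about the line \<open>Re s = 1\<close>, the at most one
  non-principal character with a zero there is left out.
\<close>

section \<open>Characters and the resonating weight\<close>

lemma dirichlet_char_mult: "dirichlet_char q \<psi> \<Longrightarrow> \<psi> (m * n) = \<psi> m * \<psi> n"
  by (simp add: dirichlet_char_def)

lemma dirichlet_char_eq_0_iff: "dirichlet_char q \<psi> \<Longrightarrow> \<psi> n = 0 \<longleftrightarrow> \<not> coprime n q"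
  by (auto simp: dirichlet_char_def)

lemma dirichlet_char_1:
  assumes "dirichlet_char q \<psi>"
  shows "\<psi> (Suc 0) = 1"
proof -
  have "\<psi> 1 = \<psi> 1 * \<psi> 1"
    using dirichlet_char_mult[OF assms, of 1 1] by simp
  moreover have "\<psi> 1 \<noteq> 0"
    using dirichlet_char_eq_0_iff[OF assms, of 1] by simp
  ultimately show ?thesis by simp
qed

lemma dirichlet_char_power: "dirichlet_char q \<psi> \<Longrightarrow> \<psi> (n ^ k) = \<psi> n ^ k"
  by (induction k) (simp_all add: dirichlet_char_mult dirichlet_char_1)

lemma dirichlet_char_mod:
  assumes "dirichlet_char q \<psi>"
  shows "\<psi> (n mod q) = \<psi> n"
proof -
  have "\<psi> (m + k * q) = \<psi> m" for m k
  proof (induction k)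
    case (Suc k)
    have "\<psi> (m + Suc k * q) = \<psi> (m + k * q + q)" by (simp add: algebra_simps)
    also have "\<dots> = \<psi> (m + k * q)" using assms unfolding dirichlet_char_def by blast
    finally show ?case using Suc by simp
  qed simp
  from this[of "n mod q" "n div q"] show ?thesis by simp
qed

lemma dirichlet_char_root_unity:
  assumes "dirichlet_char q \<psi>" "coprime n q"
  shows "\<psi> n ^ totient q = 1"
proof -
  have "[n ^ totient q = 1] (mod q)"
    by (rule euler_theorem) fact
  hence "\<psi> (n ^ totient q) = \<psi> 1"
    using dirichlet_char_mod[OF assms(1)] by (metis cong_def)
  thus ?thesis
    using assms(1) by (simp add: dirichlet_char_power dirichlet_char_1)
qed

lemma norm_dirichlet_char:
  assumes "dirichlet_char q \<psi>" "coprime n q" "q > 0"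
  shows "norm (\<psi> n) = 1"
  using dirichlet_char_root_unity[OF assms(1,2)] assms(3)
  by (metis power_eq_1_iff totient_gt_0_iff gr_implies_not0)

lemma norm_dirichlet_char_le_1:
  assumes "dirichlet_char q \<psi>" "q > 0"
  shows "norm (\<psi> n) \<le> 1"
  using norm_dirichlet_char[OF assms(1) _ assms(2), of n] dirichlet_char_eq_0_iff[OF assms(1), of n]
  by (cases "coprime n q") auto

lemma dirichlet_char_mult_char:
  "dirichlet_char q \<psi> \<Longrightarrow> dirichlet_char q \<phi> \<Longrightarrow> dirichlet_char q (\<lambda>n. \<psi> n * \<phi> n)"
  by (auto simp: dirichlet_char_def)

lemma dirichlet_char_cnj: "dirichlet_char q \<psi> \<Longrightarrow> dirichlet_char q (\<lambda>n. cnj (\<psi> n))"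
  by (auto simp: dirichlet_char_def)

lemma dirichlet_char_mult_cnj:
  "dirichlet_char q \<psi> \<Longrightarrow> q > 0 \<Longrightarrow> \<psi> n * cnj (\<psi> n) = principal_char q n"
  using norm_dirichlet_char[of q \<psi> n] dirichlet_char_eq_0_iff[of q \<psi> n]
  by (cases "coprime n q") (auto simp: complex_norm_square[symmetric] principal_char_def)

lemma dirichlet_char_nonprincipalE:
  assumes "dirichlet_char q \<psi>" "\<psi> \<noteq> principal_char q"
  obtains a where "coprime a q" "\<psi> a \<noteq> 1"
proof -
  from assms(2) obtain a where "\<psi> a \<noteq> principal_char q a" by blast
  moreover from this have "coprime a q"
    using dirichlet_char_eq_0_iff[OF assms(1), of a] by (auto simp: principal_char_def)
  ultimately show ?thesis using that by (auto simp: principal_char_def)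
qed

text \<open>A character is determined by its values below \<open>q\<close>, and each of them is 0 or
  a root of unity of order dividing \<open>totient q\<close>.\<close>

lemma finite_dirichlet_chars:
  assumes "q > 0"
  shows "finite {\<psi>. dirichlet_char q \<psi>}"
proof -
  define S where "S = insert 0 {z :: complex. z ^ totient q = 1}"
  have "finite S"
    unfolding S_def using assms by (auto intro!: finite_roots_unity simp: Suc_le_eq)
  hence fin: "finite (PiE {..<q} (\<lambda>_. S))"
    by (intro finite_PiE) auto
  have "inj_on (\<lambda>\<psi>. restrict \<psi> {..<q}) {\<psi>. dirichlet_char q \<psi>}"
  proof (rule inj_onI, safe)
    fix \<psi> \<phi> assume 1: "dirichlet_char q \<psi>" "dirichlet_char q \<phi>"
      and eq: "restrict \<psi> {..<q} = restrict \<phi> {..<q}"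
    show "\<psi> = \<phi>"
    proof
      fix n
      have "\<psi> (n mod q) = \<phi> (n mod q)"
        using fun_cong[OF eq, of "n mod q"] assms by auto
      thus "\<psi> n = \<phi> n" using dirichlet_char_mod 1 by metis
    qed
  qed
  moreover have "(\<lambda>\<psi>. restrict \<psi> {..<q}) ` {\<psi>. dirichlet_char q \<psi>} \<subseteq> PiE {..<q} (\<lambda>_. S)"
  proof -
    have "\<psi> n \<in> S" if "dirichlet_char q \<psi>" for \<psi> n
      using dirichlet_char_eq_0_iff[OF that, of n] dirichlet_char_root_unity[OF that, of n]
      unfolding S_def by blast
    thus ?thesis by (auto split: if_splits)
  qed
  ultimately show ?thesis
    using fin finite_subset inj_on_finite by blast
qed

text \<open>For a primitive root \<open>g\<close>, every (q - 1)-th root of unity \<open>z\<close>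
  yields a character with value \<open>z\<close> at \<open>g\<close>. The bound makes the total
  weight in the resonance average at least \<open>q - 1\<close>.\<close>

lemma card_dirichlet_chars_ge:
  assumes "prime q" "q > 2"
  shows "card {\<psi>. dirichlet_char q \<psi>} \<ge> q - 1"
proof -
  obtain g where g: "residue_primroot q g"
    using prime_primitive_root_exists[of q] assms by auto
  have tot: "totient q = q - 1" using assms(1) by (simp add: totient_prime)
  have cg: "coprime q g" and ord: "ord q g = q - 1"
    using g tot by (auto simp: residue_primroot_def)
  \<comment> \<open>A discrete logarithm to base \<open>g\<close>. Only its residue modulo
    \<open>q - 1\<close> carries information; \<open>pow\<close> below shows that powers of
    \<open>z\<close> depend on nothing more.\<close>
  define ind where "ind n = (SOME i. [g ^ i = n] (mod q))" for n
  have ind: "[g ^ ind n = n] (mod q)" if "coprime n q" for n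
  proof -
    have "n mod q \<in> totatives q"
      using that assms(2) by (simp add: totatives_def coprime_mod_left_iff mod_greater_zero_iff_not_dvd)
        (use coprime_absorb_right not_coprimeI in fastforce)
    hence "n mod q \<in> (\<lambda>i. g ^ i mod q) ` {..<totient q}"
      using residue_primroot_is_generator[OF _ g] assms by (simp add: bij_betw_def)
    then obtain i where "[g ^ i = n] (mod q)" by (auto simp: cong_def)
    thus ?thesis unfolding ind_def by (rule someI)
  qed
  define X where "X z n = (if coprime n q then z ^ ind n else 0)" for z :: complex and n
  have pow: "z ^ i = z ^ j" if "z ^ (q - 1) = 1" "[g ^ i = g ^ j] (mod q)" for z :: complex and i j
  proof -
    have "[i = j] (mod (q - 1))"
      using order_divides_expdiff[OF cg, of i j] that(2) ord by simp
    moreover have "z ^ i = z ^ (i mod (q - 1))" for i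
      using that(1) by (metis mult_div_mod_eq power_add power_mult power_one mult_1)
    ultimately show ?thesis by (metis cong_def)
  qed
  have char: "dirichlet_char q (X z)" if z: "z ^ (q - 1) = 1" for z
    unfolding dirichlet_char_def
  proof (intro conjI allI)
    fix m n
    show "X z (m * n) = X z m * X z n"
    proof (cases "coprime m q \<and> coprime n q")
      case True
      hence "[g ^ ind (m * n) = m * n] (mod q)" "[g ^ ind m * g ^ ind n = m * n] (mod q)"
        using ind[of m] ind[of n] ind[of "m * n"] by (auto intro: cong_mult)
      hence "[g ^ ind (m * n) = g ^ (ind m + ind n)] (mod q)"
        unfolding power_add using cong_sym cong_trans by blast
      from pow[OF z this] True show ?thesis by (simp add: X_def power_add)
    next
      case False
      hence "\<not> coprime (m * n) q" by simp
      hence "X z (m * n) = 0" unfolding X_def by presburger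
      moreover have "X z m = 0 \<or> X z n = 0" using False unfolding X_def by presburger
      ultimately show ?thesis by auto
    qed
  next
    fix n
    have cop: "coprime (n + q) q \<longleftrightarrow> coprime n q" by (simp only: coprime_iff_gcd_eq_1 gcd_add1)
    show "X z (n + q) = X z n"
    proof (cases "coprime n q")
      case True
      hence "[g ^ ind (n + q) = g ^ ind n] (mod q)"
        using ind[of n] ind[of "n + q"] cop by (simp add: cong_def)
      from pow[OF z this] True cop show ?thesis by (simp add: X_def)
    qed (use cop in \<open>auto simp: X_def\<close>)
  next
    fix n
    have "z \<noteq> 0" using z assms by (auto simp: power_0_left split: if_splits)
    thus "X z n \<noteq> 0 \<longleftrightarrow> coprime n q" by (simp add: X_def)
  qed
  have Xg: "X z g = z" if "z ^ (q - 1) = 1" for z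
  proof -
    have "[g ^ ind g = g ^ 1] (mod q)" using ind[of g] cg by (simp add: coprime_commute)
    from pow[OF that this] show ?thesis using cg by (simp add: X_def coprime_commute)
  qed
  have "card {z :: complex. z ^ (q - 1) = 1} = q - 1"
    using assms by (intro card_roots_unity_eq) auto
  moreover have "card {z :: complex. z ^ (q - 1) = 1} \<le> card {\<psi>. dirichlet_char q \<psi>}"
  proof (rule card_inj_on_le)
    show "inj_on X {z. z ^ (q - 1) = 1}"
    proof (rule inj_onI)
      fix y z assume yz: "y \<in> {z. z ^ (q - 1) = 1}" "z \<in> {z. z ^ (q - 1) = 1}" "X y = X z"
      have "X y g = y" by (rule Xg) (use yz(1) in blast)
      moreover have "X z g = z" by (rule Xg) (use yz(2) in blast)
      ultimately show "y = z" unfolding yz(3) by (rule trans[OF sym])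
    qed
    show "X ` {z. z ^ (q - 1) = 1} \<subseteq> {\<psi>. dirichlet_char q \<psi>}"
      using char by blast
    show "finite {\<psi>. dirichlet_char q \<psi>}"
      by (rule finite_dirichlet_chars) (use assms(2) in linarith)
  qed
  ultimately show ?thesis by simp
qed

section \<open>Orthogonality and weighted correlations\<close>

lemma sum_nonneg_Reals: "(\<And>x. x \<in> A \<Longrightarrow> f x \<in> \<real>\<^sub>\<ge>\<^sub>0) \<Longrightarrow> sum f A \<in> (\<real>\<^sub>\<ge>\<^sub>0 :: complex set)"
  by (induction A rule: infinite_finite_induct) (auto intro: nonneg_Reals_add_I)

text \<open>Multiplication by a character \<open>\<phi>\<close> permutes the characters, so
  multiplying the sum by \<open>\<phi> a * cnj (\<phi> b)\<close> does not change it. If some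
  \<open>\<phi>\<close> makes this factor different from 0 and 1, the sum vanishes; otherwise every
  term is 0 or 1.\<close>

lemma dirichlet_char_orthogonality_nonneg:
  assumes "q > 0"
  shows "(\<Sum>\<psi> | dirichlet_char q \<psi>. \<psi> a * cnj (\<psi> b)) \<in> \<real>\<^sub>\<ge>\<^sub>0"
proof (cases "\<exists>\<phi>. dirichlet_char q \<phi> \<and> \<phi> a * cnj (\<phi> b) \<notin> {0, 1}")
  case True
  let ?C = "{\<psi>. dirichlet_char q \<psi>}"
  from True obtain \<phi> where \<phi>: "dirichlet_char q \<phi>" "\<phi> a * cnj (\<phi> b) \<noteq> 0" "\<phi> a * cnj (\<phi> b) \<noteq> 1"
    by auto
  define S where "S = (\<Sum>\<psi>\<in>?C. \<psi> a * cnj (\<psi> b))"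
  have inv: "(\<lambda>n. \<phi> n * (cnj (\<phi> n) * \<psi> n)) = \<psi>" if "dirichlet_char q \<psi>" for \<psi>
  proof
    fix n
    show "\<phi> n * (cnj (\<phi> n) * \<psi> n) = \<psi> n"
      using dirichlet_char_mult_cnj[OF \<phi>(1) assms, of n] dirichlet_char_eq_0_iff[OF that, of n]
      by (auto simp: principal_char_def mult.assoc[symmetric])
  qed
  have "(\<Sum>\<psi>\<in>?C. (\<phi> a * cnj (\<phi> b)) * (\<psi> a * cnj (\<psi> b))) = S"
    unfolding S_def
  proof (rule sum.reindex_bij_witness[of _ "\<lambda>\<psi> n. cnj (\<phi> n) * \<psi> n" "\<lambda>\<psi> n. \<phi> n * \<psi> n"])
    fix \<psi> assume "\<psi> \<in> ?C"
    thus "(\<lambda>n. cnj (\<phi> n) * (\<phi> n * \<psi> n)) = \<psi>"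
      using inv[of \<psi>] by (simp add: mult_ac)
  qed (use \<phi>(1) inv in \<open>auto intro!: dirichlet_char_mult_char dirichlet_char_cnj\<close>)
  hence "(\<phi> a * cnj (\<phi> b)) * S = S"
    by (simp add: sum_distrib_left S_def)
  with \<phi>(3) have "S = 0" by simp
  thus ?thesis by (simp add: S_def)
next
  case False
  thus ?thesis
    by (intro sum_nonneg_Reals) auto
qed

text \<open>A factor equals \<open>|1 + \<psi>(p)|^2\<close> when \<open>\<psi> p\<close> has
  modulus 1, that is, for \<open>p\<close> coprime to the modulus.\<close>

definition resonance :: "nat set \<Rightarrow> (nat \<Rightarrow> complex) \<Rightarrow> real" where
  "resonance P \<psi> = (\<Prod>p\<in>P. 2 + 2 * Re (\<psi> p))"

lemma resonance_bounds:
  assumes "dirichlet_char q \<psi>" "q > 0"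
  shows "resonance P \<psi> \<ge> 0" "resonance P \<psi> \<le> 4 ^ card P"
proof -
  have *: "\<bar>Re (\<psi> p)\<bar> \<le> 1" for p
    using norm_dirichlet_char_le_1[OF assms, of p] abs_Re_le_cmod order_trans by blast
  have le: "0 \<le> 2 + 2 * Re (\<psi> p)" "2 + 2 * Re (\<psi> p) \<le> 4" for p
    using *[of p] by linarith+
  show "resonance P \<psi> \<ge> 0"
    unfolding resonance_def by (intro prod_nonneg ballI le)
  have "resonance P \<psi> \<le> (\<Prod>p\<in>P. 4)"
    unfolding resonance_def by (intro prod_mono conjI le)
  thus "resonance P \<psi> \<le> 4 ^ card P" by simp
qed

text \<open>Two arguments are kept because expanding the factor at a prime \<open>p\<close>
  multiplies either \<open>a\<close> or, through the conjugate, \<open>b\<close> by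
  \<open>p\<close>.\<close>

definition res_corr :: "nat \<Rightarrow> nat set \<Rightarrow> nat \<Rightarrow> nat \<Rightarrow> complex" where
  "res_corr q P a b = (\<Sum>\<psi> | dirichlet_char q \<psi>. resonance P \<psi> * (\<psi> a * cnj (\<psi> b)))"

lemma res_corr_insert:
  assumes "finite P" "p \<notin> P"
  shows "res_corr q (insert p P) a b =
           2 * res_corr q P a b + res_corr q P (p * a) b + res_corr q P a (p * b)"
proof -
  have "resonance (insert p P) \<psi> * (\<psi> a * cnj (\<psi> b)) =
          2 * (resonance P \<psi> * (\<psi> a * cnj (\<psi> b))) +
          resonance P \<psi> * (\<psi> (p * a) * cnj (\<psi> b)) +
          resonance P \<psi> * (\<psi> a * cnj (\<psi> (p * b)))" if "dirichlet_char q \<psi>" for \<psi>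
  proof -
    have "complex_of_real (resonance (insert p P) \<psi>) = (2 + (\<psi> p + cnj (\<psi> p))) * resonance P \<psi>"
      using assms by (simp add: resonance_def complex_add_cnj)
    thus ?thesis
      using that by (simp add: dirichlet_char_mult algebra_simps)
  qed
  thus ?thesis
    by (simp add: res_corr_def sum.distrib sum_distrib_left)
qed

text \<open>The recursion over \<open>P\<close> has nonnegative coefficients, and for empty
  \<open>P\<close> the claim is orthogonality. The recursion changes \<open>a\<close> and
  \<open>b\<close>, so the induction runs over arbitrary ones.\<close>

lemma res_corr_nonneg:
  assumes "finite P" "q > 0"
  shows "res_corr q P a b \<in> \<real>\<^sub>\<ge>\<^sub>0"
  using assms(1)
proof (induction P arbitrary: a b)
  case empty
  thus ?case
    using dirichlet_char_orthogonality_nonneg[OF assms(2)] by (simp add: res_corr_def resonance_def)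
next
  case (insert p P)
  have "2 * res_corr q P a b \<in> \<real>\<^sub>\<ge>\<^sub>0"
    using nonneg_Reals_add_I[OF insert.IH[of a b] insert.IH[of a b]] by simp
  thus ?case
    using insert by (simp add: res_corr_insert nonneg_Reals_add_I)
qed

lemma res_corr_1_1: "res_corr q P 1 1 = of_real (\<Sum>\<psi> | dirichlet_char q \<psi>. resonance P \<psi>)"
  by (simp add: res_corr_def dirichlet_char_1)

text \<open>For empty \<open>P\<close> all weights are 1. Inserting a prime doubles the total and
  adds two nonnegative correlations.\<close>

lemma sum_resonance_ge:
  assumes "finite P" "q > 0"
  shows "(\<Sum>\<psi> | dirichlet_char q \<psi>. resonance P \<psi>) \<ge> card {\<psi>. dirichlet_char q \<psi>}"
proof -
  have "Re (res_corr q P 1 1) \<ge> card {\<psi>. dirichlet_char q \<psi>}"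
    using assms(1)
  proof (induction P)
    case (insert p P)
    from insert have "Re (res_corr q (insert p P) 1 1) =
      2 * Re (res_corr q P 1 1) + Re (res_corr q P p 1) + Re (res_corr q P 1 p)"
      by (simp add: res_corr_insert)
    moreover have "Re (res_corr q P a b) \<ge> 0" for a b
      using res_corr_nonneg[OF insert(1) assms(2), of a b] by (simp add: complex_nonneg_Reals_iff)
    ultimately show ?case using insert.IH by (smt (verit))
  qed (simp add: res_corr_1_1[unfolded One_nat_def] resonance_def)
  thus ?thesis by (simp only: res_corr_1_1 Re_complex_of_real)
qed

text \<open>Let c be the real part of the correlation for \<open>Q = P - {p}\<close>. The left side
  is 2c(p,1) + c(p^2,1) + c(p,p), the total weight is 2c(1,1) + 2c(p,1), and c(p,p) = c(1,1) because
  \<open>\<psi> p\<close> has modulus 1. Twice the former minus the latter is 2c(p,1) + 2c(p^2,1),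
  which is nonnegative.\<close>

lemma res_corr_ge_half:
  assumes "finite P" "q > 0" "p \<in> P" "coprime p q"
  shows "Re (res_corr q P p 1) \<ge> (\<Sum>\<psi> | dirichlet_char q \<psi>. resonance P \<psi>) / 2"
proof -
  define Q where "Q = P - {p}"
  have Q: "finite Q" "p \<notin> Q" "P = insert p Q"
    using assms by (auto simp: Q_def)
  have nonneg: "Re (res_corr q Q a b) \<ge> 0" for a b
    using res_corr_nonneg[OF Q(1) assms(2), of a b] by (simp add: complex_nonneg_Reals_iff)
  have sym: "Re (res_corr q Q 1 p) = Re (res_corr q Q p 1)"
    by (simp add: res_corr_def dirichlet_char_1)
  have eq: "res_corr q Q p p = res_corr q Q 1 1"
    unfolding res_corr_def
    using assms by (intro sum.cong) (simp_all add: dirichlet_char_mult_cnj principal_char_def dirichlet_char_1)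
  have "2 * Re (res_corr q P p 1) - Re (res_corr q P 1 1) =
      2 * Re (res_corr q Q p 1) + 2 * Re (res_corr q Q (p * p) 1)"
    using Q sym eq by (simp add: res_corr_insert)
  hence "2 * Re (res_corr q P p 1) \<ge> Re (res_corr q P 1 1)"
    using nonneg[of p 1] nonneg[of "p * p" 1] by linarith
  thus ?thesis by (simp only: res_corr_1_1 Re_complex_of_real)
qed

section \<open>The L-function of a non-principal character\<close>

text \<open>Multiplication by a unit \<open>a\<close> with \<open>\<psi> a \<noteq> 1\<close>
  permutes the residues and multiplies the sum by \<open>\<psi> a\<close>.\<close>

lemma sum_nonprincipal_char_eq_0:
  assumes "dirichlet_char q \<psi>" "\<psi> \<noteq> principal_char q" "q > 0"
  shows "(\<Sum>n<q. \<psi> n) = 0"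
proof -
  obtain a where a: "coprime a q" "\<psi> a \<noteq> 1"
    using dirichlet_char_nonprincipalE assms by metis
  have inj: "inj_on (\<lambda>n. a * n mod q) {..<q}"
  proof (rule inj_onI)
    fix m n assume mn: "m \<in> {..<q}" "n \<in> {..<q}" and "a * m mod q = a * n mod q"
    hence "[a * m = a * n] (mod q)" by (simp add: cong_def)
    hence "[m = n] (mod q)" using a(1) by (simp add: cong_mult_lcancel_nat)
    thus "m = n" using mn by (simp add: cong_def)
  qed
  have "(\<lambda>n. a * n mod q) ` {..<q} = {..<q}"
    by (rule endo_inj_surj[OF _ _ inj]) (use assms(3) in auto)
  hence "(\<Sum>n<q. \<psi> n) = (\<Sum>n<q. \<psi> (a * n mod q))"
    using sum.reindex[OF inj, of \<psi>] by simp
  also have "\<dots> = \<psi> a * (\<Sum>n<q. \<psi> n)"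
    by (simp add: dirichlet_char_mod[OF assms(1)] dirichlet_char_mult[OF assms(1)] sum_distrib_left)
  finally show ?thesis using a(2) by simp
qed

text \<open>Whole periods cancel, leaving fewer than \<open>q\<close> terms of modulus at most
  1.\<close>

lemma norm_sum_nonprincipal_char_le:
  assumes "dirichlet_char q \<psi>" "\<psi> \<noteq> principal_char q" "q > 0"
  shows "norm (\<Sum>n<N. \<psi> n) \<le> q"
proof (induction N rule: less_induct)
  case (less N)
  show ?case
  proof (cases "N < q")
    case True
    have "norm (\<Sum>n<N. \<psi> n) \<le> (\<Sum>n<N. 1)"
      by (intro sum_norm_le norm_dirichlet_char_le_1[OF assms(1,3)])
    thus ?thesis using True by simp
  next
    case False
    have "(\<Sum>n<N. \<psi> n) = (\<Sum>n<q. \<psi> n) + (\<Sum>n=q..<N. \<psi> n)"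
      using False by (metis (no_types) atLeast0LessThan not_less sum.atLeastLessThan_concat zero_le)
    also have "(\<Sum>n=q..<N. \<psi> n) = (\<Sum>n<N - q. \<psi> (n + q))"
      using False by (intro sum.reindex_bij_witness[of _ "\<lambda>n. n + q" "\<lambda>n. n - q"]) auto
    also have "\<dots> = (\<Sum>n<N - q. \<psi> n)"
      using assms(1) by (simp add: dirichlet_char_def)
    finally have "(\<Sum>n<N. \<psi> n) = (\<Sum>n<N - q. \<psi> n)"
      using sum_nonprincipal_char_eq_0[OF assms] by simp
    thus ?thesis
      using less[of "N - q"] False assms(3) by simp
  qed
qed

text \<open>Mean value inequality on the segment: the derivative \<open>-s * z powr (-s - 1)\<close>
  is largest in modulus at the left end.\<close>

lemma norm_powr_diff_le:
  fixes s :: complex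
  assumes "x > 0" "Re s > 0"
  shows "norm (of_real x powr (-s) - of_real (x + 1) powr (-s)) \<le> norm s * x powr (- Re s - 1)"
proof -
  let ?S = "closed_segment (complex_of_real x) (of_real (x + 1))"
  have S: "\<exists>t\<in>{x..x+1}. z = of_real t" if "z \<in> ?S" for z
    using that unfolding closed_segment_of_real by (auto simp: closed_segment_eq_real_ivl)
  have "norm (of_real x powr (-s) - of_real (x + 1) powr (-s)) \<le>
          (norm s * x powr (- Re s - 1)) * norm (complex_of_real x - of_real (x + 1))"
  proof (rule field_differentiable_bound[where S = ?S and f' = "\<lambda>z. -s * z powr (-s-1)"])
    fix z assume "z \<in> ?S"
    then obtain t where t: "t \<in> {x..x+1}" "z = of_real t" using S by blast
    show "((\<lambda>z. z powr - s) has_field_derivative - s * z powr (- s - 1)) (at z within ?S)"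
      using t assms by (intro has_field_derivative_at_within[OF has_field_derivative_powr])
        (auto simp: complex_nonpos_Reals_iff)
    have "norm (z powr (-s - 1)) = t powr (- Re s - 1)"
      using t assms by (simp add: norm_powr_real_powr)
    also have "\<dots> \<le> x powr (- Re s - 1)"
      using t assms by (intro powr_mono2') auto
    finally show "norm (- s * z powr (- s - 1)) \<le> norm s * x powr (- Re s - 1)"
      by (simp add: norm_mult mult_left_mono)
  qed auto
  thus ?thesis by (simp flip: of_real_diff)
qed

section \<open>Summation by parts and continuation to \<open>Re s > 0\<close>\<close>

lemma summable_Suc_powr: "a < -1 \<Longrightarrow> summable (\<lambda>n. real (Suc n) powr a)"
  using summable_real_powr_iff[of a] summable_Suc_iff[of "\<lambda>n. real n powr a"] by simp

definition char_sum :: "(nat \<Rightarrow> complex) \<Rightarrow> nat \<Rightarrow> complex" where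
  "char_sum \<psi> N = (\<Sum>n<N. \<psi> (Suc n))"

text \<open>A term of the L-series after summation by parts. The character sums are bounded for
  non-principal \<open>\<psi>\<close> and the differences have size
  \<open>n powr (- Re s - 1)\<close>, so these terms are absolutely summable for
  \<open>Re s > 0\<close>.\<close>

definition abel_term :: "(nat \<Rightarrow> complex) \<Rightarrow> complex \<Rightarrow> nat \<Rightarrow> complex" where
  "abel_term \<psi> s n = char_sum \<psi> (Suc n) * (of_nat (Suc n) powr (-s) - of_nat (Suc (Suc n)) powr (-s))"

lemma norm_char_sum_le:
  assumes "dirichlet_char q \<psi>" "\<psi> \<noteq> principal_char q" "q > 0"
  shows "norm (char_sum \<psi> N) \<le> 2 * real q"
proof -
  have "char_sum \<psi> N = (\<Sum>n<Suc N. \<psi> n) - \<psi> 0"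
    unfolding char_sum_def by (subst sum.lessThan_Suc_shift) simp
  also have "norm \<dots> \<le> real q + 1"
    by (intro order_trans[OF norm_triangle_ineq4] add_mono norm_sum_nonprincipal_char_le
          norm_dirichlet_char_le_1[of q] assms)
  finally show ?thesis using assms(3) by simp
qed

lemma norm_abel_term_le:
  assumes "dirichlet_char q \<psi>" "\<psi> \<noteq> principal_char q" "q > 0" "Re s > 0"
  shows "norm (abel_term \<psi> s n) \<le> 2 * real q * norm s * real (Suc n) powr (- Re s - 1)"
proof -
  have "norm (abel_term \<psi> s n) \<le> (2 * real q) * (norm s * real (Suc n) powr (- Re s - 1))"
    unfolding abel_term_def norm_mult
    using norm_powr_diff_le[of "real (Suc n)" s] assms
    by (intro mult_mono norm_char_sum_le[OF assms(1-3)]) (auto simp: add_ac)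
  thus ?thesis by (simp add: mult_ac)
qed

lemma summation_by_parts_char_sum:
  "(\<Sum>n<N. \<psi> (Suc n) * of_nat (Suc n) powr (-s)) =
     char_sum \<psi> N * of_nat (Suc N) powr (-s) + (\<Sum>n<N. abel_term \<psi> s n)"
  by (induction N) (simp_all add: char_sum_def abel_term_def algebra_simps)

lemma abel_term_sums_L_series:
  assumes "dirichlet_char q \<psi>" "\<psi> \<noteq> principal_char q" "q > 0" "Re s > 0"
  shows "(\<lambda>n. \<psi> (Suc n) / of_nat (Suc n) powr s) sums (\<Sum>n. abel_term \<psi> s n)"
proof -
  have sum: "summable (\<lambda>n. 2 * real q * norm s * real (Suc n) powr (- Re s - 1))"
    using assms by (intro summable_mult summable_Suc_powr) simp
  have "summable (abel_term \<psi> s)"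
    using norm_abel_term_le[OF assms] by (intro summable_comparison_test'[OF sum, of 0]) simp
  hence 1: "(\<lambda>N. \<Sum>n<N. abel_term \<psi> s n) \<longlonglongrightarrow> (\<Sum>n. abel_term \<psi> s n)"
    by (rule summable_LIMSEQ)
  have lim: "(\<lambda>N. 2 * real q * real (Suc N) powr (- Re s)) \<longlonglongrightarrow> 0"
    using assms(4) by real_asymp
  \<comment> \<open>The boundary term vanishes in the limit: a bounded character sum times a
    decaying power.\<close>
  have "(\<lambda>N. char_sum \<psi> N * of_nat (Suc N) powr (-s)) \<longlonglongrightarrow> 0"
  proof (rule Lim_null_comparison[OF _ lim], rule always_eventually, rule allI)
    fix N
    have "norm (of_nat (Suc N) powr (-s)) = real (Suc N) powr (- Re s)"
      by (subst norm_powr_real_powr) auto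
    thus "norm (char_sum \<psi> N * of_nat (Suc N) powr (-s)) \<le> 2 * real q * real (Suc N) powr (- Re s)"
      using norm_char_sum_le[OF assms(1-3), of N] by (simp only: norm_mult mult_right_mono powr_ge_zero)
  qed
  from tendsto_add[OF this 1]
  have "(\<lambda>N. \<Sum>n<N. \<psi> (Suc n) * of_nat (Suc n) powr (-s)) \<longlonglongrightarrow> (\<Sum>n. abel_term \<psi> s n)"
    by (simp only: add_0 summation_by_parts_char_sum)
  thus ?thesis
    by (simp only: sums_def powr_minus_divide times_divide_eq_right mult_1_right)
qed

lemma abel_series_holomorphic:
  assumes "dirichlet_char q \<psi>" "\<psi> \<noteq> principal_char q" "q > 0"
  shows "(\<lambda>s. \<Sum>n. abel_term \<psi> s n) holomorphic_on {s. Re s > 0}"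
proof (rule holomorphic_uniform_sequence[where f = "\<lambda>N s. \<Sum>n<N. abel_term \<psi> s n"])
  show "open {s. Re s > 0}" by (rule open_halfspace_Re_gt)
  show "(\<lambda>s. \<Sum>n<N. abel_term \<psi> s n) holomorphic_on {s. Re s > 0}" for N
    unfolding abel_term_def by (intro holomorphic_intros)
next
  fix s0 assume "s0 \<in> {s. Re s > 0}"
  hence s0: "Re s0 > 0" by simp
  \<comment> \<open>With half the distance to the imaginary axis as radius, the closed disc stays in
    \<open>Re s \<ge> d\<close>, so a single summable majorant serves the whole disc.\<close>
  define d where "d = Re s0 / 2"
  have d: "d > 0" using s0 by (simp add: d_def)
  have Re_ge: "Re s \<ge> d" if "s \<in> cball s0 d" for s
    using that abs_Re_le_cmod[of "s0 - s"] by (auto simp: d_def dist_norm)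
  have norm_le: "norm s \<le> norm s0 + d" if "s \<in> cball s0 d" for s
    using that norm_triangle_sub[of s s0] by (simp add: dist_norm norm_minus_commute)
  have "uniform_limit (cball s0 d) (\<lambda>N s. \<Sum>n<N. abel_term \<psi> s n) (\<lambda>s. \<Sum>n. abel_term \<psi> s n) sequentially"
  proof (rule Weierstrass_m_test[where M = "\<lambda>n. 2 * real q * (norm s0 + d) * real (Suc n) powr (- d - 1)"])
    fix n s assume s: "s \<in> cball s0 d"
    have "norm (abel_term \<psi> s n) \<le> 2 * real q * norm s * real (Suc n) powr (- Re s - 1)"
      using Re_ge[OF s] d by (intro norm_abel_term_le assms) auto
    also have "\<dots> \<le> 2 * real q * (norm s0 + d) * real (Suc n) powr (- d - 1)"
      using Re_ge[OF s] norm_le[OF s] d by (intro mult_mono powr_mono) auto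
    finally show "norm (abel_term \<psi> s n) \<le> 2 * real q * (norm s0 + d) * real (Suc n) powr (- d - 1)" .
  next
    show "summable (\<lambda>n. 2 * real q * (norm s0 + d) * real (Suc n) powr (- d - 1))"
      using d by (intro summable_mult summable_Suc_powr) simp
  qed
  moreover have "cball s0 d \<subseteq> {s. Re s > 0}" using Re_ge d by force
  ultimately show "\<exists>d>0. cball s0 d \<subseteq> {s. 0 < Re s} \<and>
      uniform_limit (cball s0 d) (\<lambda>N s. \<Sum>n<N. abel_term \<psi> s n) (\<lambda>s. \<Sum>n. abel_term \<psi> s n) sequentially"
    using d by blast
qed

text \<open>The series summed by parts is a witness for the choice in \<open>dirichlet_L\<close>, so
  the chosen function has the properties demanded there.\<close>

lemma dirichlet_L_nonprincipal:
  assumes "dirichlet_char q \<psi>" "\<psi> \<noteq> principal_char q" "q > 0"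
  shows "dirichlet_L q \<psi> holomorphic_on {s. Re s > 0}"
    and "Re s > 1 \<Longrightarrow> (\<lambda>n. \<psi> (Suc n) / of_nat (Suc n) powr s) sums dirichlet_L q \<psi> s"
proof -
  have "\<exists>f. f holomorphic_on {s. Re s > 0 \<and> (\<psi> = principal_char q \<longrightarrow> s \<noteq> 1)} \<and>
        (\<forall>s. Re s > 1 \<longrightarrow> (\<lambda>n. \<psi> (Suc n) / of_nat (Suc n) powr s) sums f s)"
    using abel_series_holomorphic[OF assms] abel_term_sums_L_series[OF assms] assms(2) by auto
  from someI_ex[OF this] show "dirichlet_L q \<psi> holomorphic_on {s. Re s > 0}"
    and "Re s > 1 \<Longrightarrow> (\<lambda>n. \<psi> (Suc n) / of_nat (Suc n) powr s) sums dirichlet_L q \<psi> s"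
    unfolding dirichlet_L_def[symmetric] using assms(2) by auto
qed

lemma dirichlet_L_nonprincipal_eq:
  assumes "dirichlet_char q \<psi>" "\<psi> \<noteq> principal_char q" "q > 0" "Re s > 0"
  shows "dirichlet_L q \<psi> s = (\<Sum>n. abel_term \<psi> s n)"
proof (rule analytic_continuation_open[where s = "{s. Re s > 1}" and s' = "{s. Re s > 0}" and
      f = "dirichlet_L q \<psi>" and g = "\<lambda>s. \<Sum>n. abel_term \<psi> s n"])
  show "{s. Re s > 1} \<noteq> {}" by (auto intro!: exI[of _ 2])
  show "connected {s. Re s > 0}"
    by (intro convex_connected convex_halfspace_Re_gt)
  show "dirichlet_L q \<psi> holomorphic_on {s. Re s > 0}"
    by (rule dirichlet_L_nonprincipal[OF assms(1-3)])
  show "(\<lambda>s. \<Sum>n. abel_term \<psi> s n) holomorphic_on {s. Re s > 0}"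
    by (rule abel_series_holomorphic[OF assms(1-3)])
  show "dirichlet_L q \<psi> s = (\<Sum>n. abel_term \<psi> s n)" if "s \<in> {s. Re s > 1}" for s
    using sums_unique2[OF dirichlet_L_nonprincipal(2)[OF assms(1-3)] abel_term_sums_L_series[OF assms(1-3)], of s]
      that by simp
qed (use assms in \<open>auto intro: open_halfspace_Re_gt\<close>)

text \<open>The growth is linear in \<open>q\<close>, so the real part of \<open>log L\<close> is at
  most \<open>ln q\<close> plus a constant on bounded sets; this feeds Borel-Caratheodory.\<close>

lemma norm_dirichlet_L_nonprincipal_le:
  assumes "dirichlet_char q \<psi>" "\<psi> \<noteq> principal_char q" "q > 0" "Re s \<ge> \<delta>" "\<delta> > 0"
  shows "norm (dirichlet_L q \<psi> s) \<le> 2 * real q * norm s * (\<Sum>n. real (Suc n) powr (- \<delta> - 1))"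
proof -
  have sum: "summable (\<lambda>n. real (Suc n) powr (- \<delta> - 1))"
    using assms by (intro summable_Suc_powr) simp
  have "norm (abel_term \<psi> s n) \<le> 2 * real q * norm s * real (Suc n) powr (- \<delta> - 1)" for n
  proof -
    have "norm (abel_term \<psi> s n) \<le> 2 * real q * norm s * real (Suc n) powr (- Re s - 1)"
      using assms by (intro norm_abel_term_le) auto
    also have "\<dots> \<le> 2 * real q * norm s * real (Suc n) powr (- \<delta> - 1)"
      using assms by (intro mult_mono powr_mono) auto
    finally show ?thesis .
  qed
  hence "norm (\<Sum>n. abel_term \<psi> s n) \<le> (\<Sum>n. 2 * real q * norm s * real (Suc n) powr (- \<delta> - 1))"
    by (intro norm_suminf_le summable_mult sum)
  also have "\<dots> = 2 * real q * norm s * (\<Sum>n. real (Suc n) powr (- \<delta> - 1))"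
    by (rule suminf_mult[OF sum])
  finally show ?thesis
    using dirichlet_L_nonprincipal_eq[OF assms(1-3)] assms by simp
qed

section \<open>The Euler product\<close>

lemma summable_on_nat_powr: "x > 1 \<Longrightarrow> (\<lambda>n. real n powr (-x)) summable_on A"
  using summable_real_powr_iff[of "-x"]
  by (intro summable_on_subset_banach[OF summable_nonneg_imp_summable_on[of "\<lambda>n. real n powr (-x)"]]) auto

lemma infsum_tail_tendsto_0:
  fixes f :: "nat \<Rightarrow> real"
  assumes "f summable_on UNIV"
  shows "(\<lambda>N. \<Sum>\<^sub>\<infinity>n\<in>{N<..}. f n) \<longlonglongrightarrow> 0"
proof -
  have summ: "f summable_on A" for A
    using summable_on_subset_banach[OF assms] by simp
  have "(\<Sum>\<^sub>\<infinity>n\<in>{N<..}. f n) = infsum f UNIV - (\<Sum>n\<le>N. f n)" for N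
  proof -
    have "infsum f ({..N} \<union> {N<..}) = infsum f {..N} + infsum f {N<..}"
      by (rule infsum_Un_disjoint) (use summ in auto)
    moreover have "{..N} \<union> {N<..} = UNIV" by auto
    ultimately show ?thesis by simp
  qed
  moreover have "(\<lambda>N. infsum f UNIV - (\<Sum>n\<le>N. f n)) \<longlonglongrightarrow> infsum f UNIV - infsum f UNIV"
    using has_sum_imp_sums[OF has_sum_infsum[OF assms]]
    by (intro tendsto_intros) (simp add: sums_def_le)
  ultimately show ?thesis by simp
qed

text \<open>Pairs instead of the powers themselves, since the exponent enters the coefficients. By
  unique factorization a sum over pairs is still a subsum of a sum over all
  \<open>n\<close>.\<close>

definition prime_pows :: "(nat \<times> nat) set" where
  "prime_pows = {p. prime p} \<times> {1..}"

lemma inj_on_prime_pows: "inj_on (\<lambda>(p, k). p ^ k) prime_pows"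
  by (rule inj_onI) (auto simp: prime_pows_def prime_power_inj'')

lemma prime_pows_ge_2: "(p, k) \<in> prime_pows \<Longrightarrow> p ^ k \<ge> 2"
  using self_le_power[of p k] prime_ge_2_nat[of p] by (fastforce simp: prime_pows_def)

lemma prime_pows_ge_1_real:
  assumes "(p, k) \<in> prime_pows"
  shows "real p ^ k \<ge> 1"
proof -
  have "real (p ^ k) \<ge> 1" using prime_pows_ge_2[OF assms] by linarith
  thus ?thesis by simp
qed

lemma summable_on_prime_pows:
  assumes "x > 1"
  shows "(\<lambda>(p, k). real (p ^ k) powr (-x)) summable_on prime_pows"
  using summable_on_reindex[OF inj_on_prime_pows, of "\<lambda>n. real n powr (-x)"]
    summable_on_nat_powr[OF assms] by (simp add: o_def case_prod_unfold)

text \<open>Summed over \<open>prime_pows\<close> this is \<open>log \<zeta>(x)\<close> for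
  \<open>x > 1\<close>, the common majorant of the logarithms of L-functions.\<close>

definition pp_weight :: "real \<Rightarrow> nat \<times> nat \<Rightarrow> real" where
  "pp_weight x = (\<lambda>(p, k). real (p ^ k) powr (-x) / real k)"

lemma pp_weight_nonneg: "pp_weight x i \<ge> 0"
  by (simp add: pp_weight_def split: prod.splits)

lemma pp_weight_le: "i \<in> prime_pows \<Longrightarrow> pp_weight x i \<le> (case i of (p, k) \<Rightarrow> real (p ^ k) powr (-x))"
  by (auto simp: pp_weight_def prime_pows_def divide_le_eq mult_le_cancel_left1)

lemma pp_weight_summable:
  assumes "x > 1"
  shows "pp_weight x summable_on prime_pows"
  by (rule summable_on_comparison_test[OF summable_on_prime_pows[OF assms]])
     (auto intro: pp_weight_nonneg pp_weight_le[of "(a, b)" for a b, simplified])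

lemma pp_weight_antimono: "i \<in> prime_pows \<Longrightarrow> x \<le> y \<Longrightarrow> pp_weight y i \<le> pp_weight x i"
  using prime_pows_ge_1_real[of "fst i" "snd i"]
  by (auto simp: pp_weight_def split: prod.splits intro!: divide_right_mono powr_mono)

text \<open>Abstracts the terms \<open>f n * n powr (-s)\<close> of a Dirichlet series at one fixed
  \<open>s\<close> with \<open>Re s = x\<close>.\<close>

locale summable_multiplicative =
  fixes h :: "nat \<Rightarrow> complex" and x :: real
  assumes h_1: "h (Suc 0) = 1" and h_mult: "h (m * n) = h m * h n"
    and norm_h: "n > 0 \<Longrightarrow> norm (h n) \<le> real n powr (-x)" and x: "x > 1"
begin

lemma h_power: "h (n ^ k) = h n ^ k"
  by (induction k) (simp_all add: h_1 h_mult)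

lemma abs_summable_h: "(\<lambda>n. norm (h n)) summable_on {1..}"
  by (rule summable_on_comparison_test[OF summable_on_nat_powr[OF x]]) (use norm_h in auto)

lemma summable_h: "A \<subseteq> {1..} \<Longrightarrow> h summable_on A"
  using abs_summable_summable[OF abs_summable_h] summable_on_subset_banach by blast

lemma norm_h_prime: "prime p \<Longrightarrow> norm (h p) < 1"
  using norm_h[of p] prime_gt_1_nat[of p] powr_less_mono[of "-x" 0 p] x by force

text \<open>Sieve of Eratosthenes: the survivors divisible by the next prime \<open>p\<close> are
  exactly \<open>p\<close> times the survivors, and removing them contributes the factor
  \<open>1 - h p\<close>.\<close>

lemma infsum_coprime_primes:
  assumes "finite P" "\<And>p. p \<in> P \<Longrightarrow> prime p"
  shows "(\<Sum>\<^sub>\<infinity>n\<in>{n\<in>{1..}. \<forall>p\<in>P. \<not> p dvd n}. h n) = (\<Prod>p\<in>P. 1 - h p) * (\<Sum>\<^sub>\<infinity>n\<in>{1..}. h n)"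
  using assms
proof (induction P)
  case (insert p P)
  let ?A = "\<lambda>P. {n\<in>{1..}. \<forall>p\<in>P. \<not> p dvd (n::nat)}"
  have p: "prime p" using insert by simp
  have split: "?A P = ?A (insert p P) \<union> (*) p ` ?A P"
  proof (intro equalityI subsetI)
    fix n assume n: "n \<in> ?A P"
    show "n \<in> ?A (insert p P) \<union> (*) p ` ?A P"
    proof (cases "p dvd n")
      case True
      then obtain m where m: "n = p * m" by blast
      with n have "m \<in> ?A P" by auto
      with m show ?thesis by blast
    qed (use n in auto)
  next
    fix n assume "n \<in> ?A (insert p P) \<union> (*) p ` ?A P"
    thus "n \<in> ?A P"
    proof
      assume "n \<in> (*) p ` ?A P"
      then obtain m where m: "m \<in> ?A P" "n = p * m" by blast
      have "\<not> q dvd n" if "q \<in> P" for q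
      proof
        assume "q dvd n"
        moreover from that insert have "prime q" "q \<noteq> p" by auto
        ultimately have "q dvd m" using p m(2) by (metis prime_dvd_mult_iff primes_dvd_imp_eq)
        with m that show False by blast
      qed
      moreover have "n \<ge> 1" using m p by (simp add: Suc_le_eq prime_gt_0_nat)
      ultimately show ?thesis by simp
    qed auto
  qed
  have "p \<noteq> 0" using p by auto
  hence "inj_on ((*) p) (?A P)" unfolding inj_on_def by (metis mult_left_cancel)
  hence "infsum h ((*) p ` ?A P) = infsum (h \<circ> (*) p) (?A P)" by (rule infsum_reindex)
  moreover have "h \<circ> (*) p = (\<lambda>n. h p * h n)" by (rule ext) (simp only: o_def h_mult)
  moreover have "(\<Sum>\<^sub>\<infinity>n\<in>?A P. h p * h n) = h p * infsum h (?A P)"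
    by (rule infsum_cmult_right')
  ultimately have 1: "infsum h ((*) p ` ?A P) = h p * infsum h (?A P)"
    by (simp only:)
  have 2: "infsum h (?A (insert p P) \<union> (*) p ` ?A P) =
             infsum h (?A (insert p P)) + infsum h ((*) p ` ?A P)"
    by (rule infsum_Un_disjoint) (use \<open>p \<noteq> 0\<close> in \<open>auto intro!: summable_h\<close>)
  have "infsum h (?A (insert p P)) = infsum h (?A P) - h p * infsum h (?A P)"
    using 2 unfolding split[symmetric] 1 by (rule eq_diff_eq[THEN iffD2, OF sym])
  hence "infsum h (?A (insert p P)) = (1 - h p) * infsum h (?A P)"
    by (simp only: left_diff_distrib mult_1)
  moreover have "infsum h (?A P) = (\<Prod>p\<in>P. 1 - h p) * infsum h {1..}"
    using insert by blast
  ultimately show ?case using insert(1,2) by (simp add: mult.assoc)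
qed (simp add: atLeast_def)

lemma norm_h_pp: "i \<in> prime_pows \<Longrightarrow> norm (case i of (p, k) \<Rightarrow> h (p ^ k) / of_nat k) \<le> pp_weight x i"
  using norm_h[of "fst i ^ snd i"]
  by (auto simp: pp_weight_def prime_pows_def norm_divide prime_gt_0_nat intro!: divide_right_mono)

lemma summable_h_pp: "(\<lambda>(p, k). h (p ^ k) / of_nat k) summable_on prime_pows"
  by (rule abs_summable_summable[OF summable_on_comparison_test[OF pp_weight_summable[OF x]]])
     (use norm_h_pp in auto)

text \<open>With \<open>G\<close> the exponent, \<open>exp (- G)\<close> is the limit of the finite
  products of \<open>1 - h p\<close>. By the sieve, such a product times the full sum is the sum
  over the \<open>n\<close> without small prime factors, which tends to
  \<open>h 1 = 1\<close>.\<close>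

theorem euler_product: "exp (\<Sum>\<^sub>\<infinity>(p, k)\<in>prime_pows. h (p ^ k) / of_nat k) = (\<Sum>\<^sub>\<infinity>n\<in>{1..}. h n)"
proof -
  define G where "G = (\<Sum>\<^sub>\<infinity>(p, k)\<in>prime_pows. h (p ^ k) / of_nat k)"
  define P where "P N = {p::nat. prime p \<and> p \<le> N}" for N
  have finP: "finite (P N)" for N by (simp add: P_def)
  \<comment> \<open>For fixed \<open>p\<close> the sum over \<open>k\<close> is the logarithm
    series.\<close>
  have "((\<lambda>p. - Ln (1 - h p)) has_sum G) {p. prime p}"
  proof (rule has_sum_SigmaD)
    show "((\<lambda>(p, k). h (p ^ k) / of_nat k) has_sum G) (SIGMA p:{p. prime p}. {1..})"
      unfolding G_def prime_pows_def[symmetric] by (rule has_sum_infsum[OF summable_h_pp])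
  next
    fix p :: nat assume "p \<in> {p. prime p}"
    hence p: "prime p" by simp
    have z: "norm (- h p) < 1" using norm_h_prime[OF p] by simp
    from sums_minus[OF Ln_series'[OF z]] have "(\<lambda>k. h p ^ k / of_nat k) sums (- Ln (1 - h p))"
      by simp
    moreover have "summable (\<lambda>k. norm (h p ^ k / of_nat k))"
    proof (rule summable_comparison_test'[where N = 1])
      show "summable (\<lambda>k. norm (h p) ^ k)" using z by (intro summable_geometric) simp
    qed (auto simp: norm_divide norm_power divide_le_eq mult_le_cancel_left1)
    ultimately have "((\<lambda>k. h p ^ k / of_nat k) has_sum (- Ln (1 - h p))) UNIV"
      by (intro norm_summable_imp_has_sum)
    \<comment> \<open>The term at \<open>k = 0\<close> has denominator \<open>of_nat 0\<close> and
      is therefore 0.\<close>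
    hence "((\<lambda>k. h p ^ k / of_nat k) has_sum (- Ln (1 - h p))) {1..}"
      by (rule has_sum_cong_neutral[THEN iffD1, rotated -1]) (auto simp: not_le)
    thus "((\<lambda>k. case (p, k) of (p, k) \<Rightarrow> h (p ^ k) / of_nat k) has_sum - Ln (1 - h p)) {1..}"
      by (simp add: h_power)
  qed
  hence "((\<lambda>X. \<Sum>p\<in>X. - Ln (1 - h p)) \<longlongrightarrow> G) (finite_subsets_at_top {p. prime p})"
    by (simp add: has_sum_def)
  \<comment> \<open>The sets of primes up to \<open>N\<close> exhaust the primes, so the unordered
    sum is a limit along them.\<close>
  moreover have "filterlim P (finite_subsets_at_top {p. prime p}) sequentially"
    unfolding filterlim_finite_subsets_at_top
  proof safe
    fix X :: "nat set" assume X: "finite X" "X \<subseteq> {p. prime p}"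
    show "\<forall>\<^sub>F N in sequentially. finite (P N) \<and> X \<subseteq> P N \<and> P N \<subseteq> {p. prime p}"
      using eventually_ge_at_top[of "Max X"]
    proof eventually_elim
      case (elim N)
      have "p \<le> N" if "p \<in> X" for p
        using Max_ge[OF X(1) that] elim by linarith
      hence "X \<subseteq> P N" using X(2) by (auto simp: P_def)
      thus ?case using finP[of N] by (auto simp: P_def)
    qed
  qed
  ultimately have "(\<lambda>N. \<Sum>p\<in>P N. - Ln (1 - h p)) \<longlonglongrightarrow> G"
    by (rule filterlim_compose)
  hence "(\<lambda>N. exp (- (\<Sum>p\<in>P N. - Ln (1 - h p))) * infsum h {1..}) \<longlonglongrightarrow> exp (- G) * infsum h {1..}"
    by (intro tendsto_intros)
  moreover have "exp (- (\<Sum>p\<in>P N. - Ln (1 - h p))) = (\<Prod>p\<in>P N. 1 - h p)" for N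
  proof -
    have "1 - h p \<noteq> 0" if "p \<in> P N" for p
      using norm_h_prime[of p] that by (auto simp: P_def)
    thus ?thesis using finP[of N] by (simp add: sum_negf exp_sum)
  qed
  ultimately have "(\<lambda>N. (\<Prod>p\<in>P N. 1 - h p) * infsum h {1..}) \<longlonglongrightarrow> exp (- G) * infsum h {1..}"
    by simp
  moreover have "(\<lambda>N. (\<Prod>p\<in>P N. 1 - h p) * infsum h {1..}) \<longlonglongrightarrow> 1"
  proof (rule Lim_transform[OF tendsto_const], rule Lim_null_comparison)
    show "\<forall>\<^sub>F N in sequentially. norm ((\<Prod>p\<in>P N. 1 - h p) * infsum h {1..} - 1) \<le>
            (\<Sum>\<^sub>\<infinity>n\<in>{N<..}. real n powr (-x))"
      using eventually_ge_at_top[of "1::nat"]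
    proof eventually_elim
      case (elim N)
      define A where "A = {n\<in>{1..}. \<forall>p\<in>P N. \<not> p dvd n}"
      have "1 \<in> A" by (auto simp: A_def P_def)
      \<comment> \<open>A survivor other than 1 has a prime factor, and that factor exceeds
        \<open>N\<close>.\<close>
      have sub: "A - {1} \<subseteq> {N<..}"
      proof
        fix n assume n: "n \<in> A - {1}"
        then obtain p where p: "prime p" "p dvd n" using prime_factor_nat[of n] by auto
        hence "p > N" using n by (force simp: A_def P_def)
        moreover have "p \<le> n" using p n by (intro dvd_imp_le) (auto simp: A_def)
        ultimately show "n \<in> {N<..}" by simp
      qed
      have summA: "h summable_on (A - {1})" by (intro summable_h) (auto simp: A_def)
      have "infsum h (insert 1 (A - {1})) = h 1 + infsum h (A - {1})"
        by (rule infsum_insert) (use summA in auto)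
      hence "infsum h A = 1 + infsum h (A - {1})"
        using \<open>1 \<in> A\<close> h_1 by (simp add: insert_absorb)
      moreover have "infsum h A = (\<Prod>p\<in>P N. 1 - h p) * infsum h {1..}"
        unfolding A_def by (rule infsum_coprime_primes[OF finP]) (simp add: P_def)
      ultimately have "norm ((\<Prod>p\<in>P N. 1 - h p) * infsum h {1..} - 1) = norm (infsum h (A - {1}))"
        by simp
      also have "\<dots> \<le> (\<Sum>\<^sub>\<infinity>n\<in>A - {1}. real n powr (-x))"
        by (rule norm_infsum_le[OF has_sum_infsum[OF summA] has_sum_infsum[OF summable_on_nat_powr[OF x]]])
           (auto intro!: norm_h simp: A_def)
      also have "\<dots> \<le> (\<Sum>\<^sub>\<infinity>n\<in>{N<..}. real n powr (-x))"
        by (intro infsum_mono2 summable_on_nat_powr x sub) auto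
      finally show ?case .
    qed
  qed (rule infsum_tail_tendsto_0[OF summable_on_nat_powr[OF x]])
  ultimately have "exp (- G) * infsum h {1..} = 1"
    by (rule LIMSEQ_unique)
  thus ?thesis
    by (simp add: G_def exp_minus field_simps)
qed

end

text \<open>Comparison with the integral of \<open>t powr (-x)\<close>: by the mean value theorem
  every term after the first is at most a telescoping difference.\<close>

lemma infsum_nat_powr_le:
  assumes x: "x > 1"
  shows "(\<Sum>\<^sub>\<infinity>n\<in>{1::nat..}. real n powr (-x)) \<le> x / (x - 1)"
proof -
  have step: "real (Suc n) powr (-x) \<le> (real n powr (1 - x) - real (Suc n) powr (1 - x)) / (x - 1)"
    if "n > 0" for n
  proof -
    have "\<exists>z. real n < z \<and> z < real (Suc n) \<and>
            real (Suc n) powr (1 - x) - real n powr (1 - x) = (real (Suc n) - real n) * ((1 - x) * z powr (1 - x - 1))"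
      using that by (intro MVT2) (auto intro!: derivative_eq_intros has_real_derivative_powr)
    then obtain z where z: "real n < z" "z < real (Suc n)"
      "real (Suc n) powr (1 - x) - real n powr (1 - x) = (1 - x) * z powr (-x)" by auto
    have "real (Suc n) powr (-x) \<le> z powr (-x)"
      using z x that by (intro powr_mono2') auto
    also have "\<dots> = (real n powr (1 - x) - real (Suc n) powr (1 - x)) / (x - 1)"
      using z(3) x by (simp add: field_simps)
    finally show ?thesis .
  qed
  have part: "(\<Sum>n<N. real (Suc n) powr (-x)) \<le> 1 + (1 - real N powr (1 - x)) / (x - 1)" if "N > 0" for N
    using that
  proof (induction N)
    case (Suc N)
    show ?case
    proof (cases "N = 0")
      case False
      thus ?thesis using Suc step[of N] by (simp add: diff_divide_distrib)
    qed simp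
  qed simp
  have sum: "summable (\<lambda>n. real (Suc n) powr (-x))" using x by (intro summable_Suc_powr) simp
  have "(\<Sum>n<N. real (Suc n) powr (-x)) \<le> x / (x - 1)" for N
  proof (cases "N = 0")
    case False
    have "1 + (1 - real N powr (1 - x)) / (x - 1) \<le> 1 + 1 / (x - 1)"
      using x by (intro add_left_mono divide_right_mono) auto
    also have "\<dots> = x / (x - 1)" using x by (simp add: field_simps)
    finally show ?thesis using part[of N] False by simp
  qed (use x in simp)
  hence "(\<Sum>n. real (Suc n) powr (-x)) \<le> x / (x - 1)"
    by (rule suminf_le_const[OF sum])
  moreover have "(\<lambda>n. real (Suc n) powr (-x)) sums (\<Sum>\<^sub>\<infinity>n\<in>{1..}. real n powr (-x))"
  proof (rule has_sum_imp_sums)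
    have "range Suc = {1..}" by (auto simp: image_def Suc_le_eq gr0_conv_Suc)
    thus "((\<lambda>n. real (Suc n) powr (-x)) has_sum (\<Sum>\<^sub>\<infinity>n\<in>{1..}. real n powr (-x))) UNIV"
      using has_sum_reindex[of Suc UNIV "\<lambda>n. real n powr (-x)"]
        has_sum_infsum[OF summable_on_nat_powr[OF x, of "{1..}"]]
      by (simp add: o_def)
  qed
  ultimately show ?thesis by (simp add: sums_iff)
qed

text \<open>The logarithm of the Euler product, meaningful for \<open>Re s > 1\<close>.\<close>

definition log_series :: "(nat \<Rightarrow> complex) \<Rightarrow> complex \<Rightarrow> complex" where
  "log_series f s = (\<Sum>\<^sub>\<infinity>(p, k)\<in>prime_pows. f (p ^ k) * of_nat (p ^ k) powr (-s) / of_nat k)"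

locale bounded_multiplicative =
  fixes f :: "nat \<Rightarrow> complex"
  assumes f_1: "f (Suc 0) = 1" and f_mult: "f (m * n) = f m * f n" and norm_f: "norm (f n) \<le> 1"
begin

lemma summable_multiplicative:
  assumes "Re s > 1"
  shows "summable_multiplicative (\<lambda>n. f n * of_nat n powr (-s)) (Re s)"
proof
  fix m n :: nat
  have "of_nat (m * n) powr (-s) = of_nat m powr (-s) * of_nat n powr (-s)"
    unfolding of_nat_mult by (rule powr_times_real) auto
  thus "f (m * n) * of_nat (m * n) powr (-s) = f m * of_nat m powr (-s) * (f n * of_nat n powr (-s))"
    by (simp only: f_mult mult_ac)
next
  fix n :: nat assume "n > 0"
  hence "norm (of_nat n powr (-s)) = real n powr (- Re s)"
    by (subst norm_powr_real_powr) auto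
  thus "norm (f n * of_nat n powr (-s)) \<le> real n powr (- Re s)"
    using norm_f[of n] by (simp add: norm_mult mult_left_le_one_le)
qed (use assms f_1 in auto)

lemma norm_log_series_term:
  assumes "i \<in> prime_pows"
  shows "norm (case i of (p, k) \<Rightarrow> f (p ^ k) * of_nat (p ^ k) powr (-s) / of_nat k) \<le> pp_weight (Re s) i"
proof -
  obtain p k where i: "i = (p, k)" by (cases i)
  have "p ^ k \<ge> 2" using prime_pows_ge_2 assms i by blast
  hence "p ^ k > 0" by linarith
  hence "norm (of_nat (p ^ k) powr (-s)) = real (p ^ k) powr (- Re s)"
    by (subst norm_powr_real_powr) auto
  hence "norm (f (p ^ k) * of_nat (p ^ k) powr (-s)) \<le> real (p ^ k) powr (- Re s)"
    using norm_f[of "p ^ k"] by (simp only: norm_mult mult_left_le_one_le powr_ge_zero norm_ge_zero)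
  thus ?thesis
    unfolding pp_weight_def i prod.case norm_divide norm_of_nat by (rule divide_right_mono) simp
qed

lemma summable_log_series:
  assumes "Re s > 1"
  shows "(\<lambda>(p, k). f (p ^ k) * of_nat (p ^ k) powr (-s) / of_nat k) summable_on prime_pows"
  using summable_multiplicative.summable_h_pp[OF summable_multiplicative[OF assms]] .

lemma exp_log_series_sums:
  assumes "Re s > 1"
  shows "(\<lambda>n. f (Suc n) / of_nat (Suc n) powr s) sums exp (log_series f s)"
proof -
  interpret h: summable_multiplicative "\<lambda>n. f n * of_nat n powr (-s)" "Re s"
    by (rule summable_multiplicative) fact
  have "exp (log_series f s) = (\<Sum>\<^sub>\<infinity>n\<in>{1..}. f n * of_nat n powr (-s))"
    using h.euler_product by (simp only: log_series_def)
  hence "((\<lambda>n. f n * of_nat n powr (-s)) has_sum exp (log_series f s)) {1..}"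
    using has_sum_infsum[OF h.summable_h, of "{1..}"] by simp
  moreover have "{1..} = range Suc" by (auto simp: image_def Suc_le_eq gr0_conv_Suc)
  ultimately have "((\<lambda>n. f (Suc n) * of_nat (Suc n) powr (-s)) has_sum exp (log_series f s)) UNIV"
    using has_sum_reindex[of Suc UNIV "\<lambda>n. f n * of_nat n powr (-s)"] by (simp add: o_def)
  from has_sum_imp_sums[OF this] show ?thesis
    by (simp only: powr_minus_divide times_divide_eq_right mult_1_right)
qed

lemma norm_log_series_le:
  assumes "x > 1" "Re s \<ge> x"
  shows "norm (log_series f s) \<le> (\<Sum>\<^sub>\<infinity>i\<in>prime_pows. pp_weight x i)"
  unfolding log_series_def
proof (rule norm_infsum_le[OF has_sum_infsum has_sum_infsum])
  fix i assume "i \<in> prime_pows"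
  thus "norm (case i of (p, k) \<Rightarrow> f (p ^ k) * of_nat (p ^ k) powr (-s) / of_nat k) \<le> pp_weight x i"
    using norm_log_series_term pp_weight_antimono[OF _ assms(2)] order_trans by blast
qed (use assms pp_weight_summable summable_log_series in auto)

lemma continuous_on_log_series: "continuous_on {s. Re s > 1} (log_series f)"
proof -
  have *: "continuous_on {s. Re s \<ge> x} (log_series f)" if "x > 1" for x
  proof -
    have "uniform_limit {s. Re s \<ge> x}
       (\<lambda>X s. \<Sum>i\<in>X. case i of (p, k) \<Rightarrow> f (p ^ k) * of_nat (p ^ k) powr (-s) / of_nat k)
       (\<lambda>s. \<Sum>\<^sub>\<infinity>i\<in>prime_pows. case i of (p, k) \<Rightarrow> f (p ^ k) * of_nat (p ^ k) powr (-s) / of_nat k)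
       (finite_subsets_at_top prime_pows)"
    proof (rule Weierstrass_m_test_general[OF _ pp_weight_summable[OF that]])
      fix i s assume "i \<in> prime_pows" "s \<in> {s. Re s \<ge> x}"
      thus "norm (case i of (p, k) \<Rightarrow> f (p ^ k) * of_nat (p ^ k) powr (-s) / of_nat k) \<le> pp_weight x i"
        using norm_log_series_term[of i s] pp_weight_antimono[of i x "Re s"] by force
    qed
    moreover have "continuous_on {s. Re s \<ge> x}
       (\<lambda>s. \<Sum>i\<in>X. case i of (p, k) \<Rightarrow> f (p ^ k) * of_nat (p ^ k) powr (-s) / of_nat k)"
      if "X \<subseteq> prime_pows" for X
    proof (intro continuous_on_sum)
      fix i assume "i \<in> X"
      hence "i \<in> prime_pows" using that by (rule subsetD[rotated])
      then obtain p k where i: "i = (p, k)" "(p, k) \<in> prime_pows" by (cases i) simp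
      have nz: "of_nat (p ^ k) \<noteq> (0 :: complex)" "of_nat k \<noteq> (0 :: complex)"
        using i(2) by (auto simp: prime_pows_def prime_gt_0_nat)
      have "(\<lambda>s. f (p ^ k) * of_nat (p ^ k) powr (-s) / of_nat k) holomorphic_on {s. Re s \<ge> x}"
        by (intro holomorphic_intros) (use nz in auto)
      from holomorphic_on_imp_continuous_on[OF this]
      show "continuous_on {s. Re s \<ge> x}
              (\<lambda>s. case i of (p, k) \<Rightarrow> f (p ^ k) * of_nat (p ^ k) powr (-s) / of_nat k)"
        by (simp add: i)
    qed
    ultimately show ?thesis
      unfolding log_series_def
      by (intro uniform_limit_theorem[where F = "finite_subsets_at_top prime_pows"])
         (auto intro!: eventually_finite_subsets_at_top_weakI)
  qed
  show ?thesis
  proof (rule continuous_on_eq_continuous_at[THEN iffD2, rule_format])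
    show "open {s. Re s > 1}" by (rule open_halfspace_Re_gt)
    fix s assume "s \<in> {s. Re s > 1}"
    define x where "x = (1 + Re s) / 2"
    have x: "x > 1" "s \<in> {s. Re s > x}" using \<open>s \<in> _\<close> by (auto simp: x_def field_simps)
    have "continuous_on {s. Re s > x} (log_series f)"
      by (rule continuous_on_subset[OF *[OF x(1)]]) auto
    thus "isCont (log_series f) s"
      using x(2) by (simp add: continuous_on_eq_continuous_at open_halfspace_Re_gt)
  qed
qed

text \<open>All prime powers are at least 2, so raising the exponent from 2 to \<open>x\<close>
  shrinks every term by the factor \<open>2 powr (2 - x)\<close> or more.\<close>

lemma log_series_tendsto_0: "((\<lambda>x::real. log_series f (of_real x)) \<longlongrightarrow> 0) at_top"
proof (rule Lim_null_comparison)
  define C where "C = (\<Sum>\<^sub>\<infinity>i\<in>prime_pows. pp_weight 2 i)"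
  show "((\<lambda>x. 2 powr (2 - x) * C) \<longlongrightarrow> 0) at_top" by real_asymp
  show "\<forall>\<^sub>F x in at_top. norm (log_series f (of_real x)) \<le> 2 powr (2 - x) * C"
    using eventually_ge_at_top[of 2]
  proof eventually_elim
    case (elim x)
    have "norm (log_series f (of_real x)) \<le> (\<Sum>\<^sub>\<infinity>i\<in>prime_pows. pp_weight x i)"
      using elim by (intro norm_log_series_le) auto
    also have "\<dots> \<le> (\<Sum>\<^sub>\<infinity>i\<in>prime_pows. 2 powr (2 - x) * pp_weight 2 i)"
    proof (rule infsum_mono)
      fix i assume "i \<in> prime_pows"
      then obtain p k where i: "i = (p, k)" "(p, k) \<in> prime_pows" by (cases i) auto
      have "real (p ^ k) \<ge> 2" using prime_pows_ge_2[OF i(2)] by linarith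
      hence "real (p ^ k) powr (2 - x) \<le> 2 powr (2 - x)"
        using elim by (intro powr_mono2') auto
      hence "real (p ^ k) powr (2 - x) * real (p ^ k) powr (-2) \<le> 2 powr (2 - x) * real (p ^ k) powr (-2)"
        by (rule mult_right_mono) auto
      also have "real (p ^ k) powr (2 - x) * real (p ^ k) powr (-2) = real (p ^ k) powr (-x)"
        by (simp flip: powr_add)
      finally show "pp_weight x i \<le> 2 powr (2 - x) * pp_weight 2 i"
        unfolding pp_weight_def i prod.case times_divide_eq_right by (rule divide_right_mono) simp
    qed (use elim in \<open>auto intro!: pp_weight_summable summable_on_cmult_right\<close>)
    also have "\<dots> = 2 powr (2 - x) * C"
      unfolding C_def by (rule infsum_cmult_right') 
    finally show ?case .
  qed
qed

end

text \<open>The Euler product for \<open>h n = n powr (-x)\<close> turns the left side into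
  \<open>\<zeta>(x)\<close>.\<close>

lemma exp_infsum_pp_weight_le:
  assumes "x > 1"
  shows "exp (\<Sum>\<^sub>\<infinity>i\<in>prime_pows. pp_weight x i) \<le> x / (x - 1)"
proof -
  interpret h: summable_multiplicative "\<lambda>n. complex_of_real (real n powr (-x))" x
  proof
    fix m n :: nat
    show "complex_of_real (real (m * n) powr (-x)) =
            complex_of_real (real m powr (-x)) * complex_of_real (real n powr (-x))"
      by (simp only: of_nat_mult powr_mult of_nat_0_le_iff of_real_mult)
  qed (use assms in auto)
  have "(\<Sum>\<^sub>\<infinity>(p, k)\<in>prime_pows. complex_of_real (real (p ^ k) powr (-x)) / of_nat k) =
          (\<Sum>\<^sub>\<infinity>i\<in>prime_pows. complex_of_real (pp_weight x i))"
    by (intro infsum_cong) (auto simp: pp_weight_def)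
  also have "\<dots> = of_real (\<Sum>\<^sub>\<infinity>i\<in>prime_pows. pp_weight x i)"
    by (rule infsumI has_sum_of_real has_sum_infsum pp_weight_summable assms)+
  finally have "complex_of_real (exp (\<Sum>\<^sub>\<infinity>i\<in>prime_pows. pp_weight x i)) =
      (\<Sum>\<^sub>\<infinity>n\<in>{1..}. complex_of_real (real n powr (-x)))"
    using h.euler_product by (simp add: exp_of_real)
  also have "\<dots> = of_real (\<Sum>\<^sub>\<infinity>n\<in>{1..}. real n powr (-x))"
    by (rule infsumI has_sum_of_real has_sum_infsum summable_on_nat_powr assms)+
  finally have "exp (\<Sum>\<^sub>\<infinity>i\<in>prime_pows. pp_weight x i) = (\<Sum>\<^sub>\<infinity>n\<in>{1::nat..}. real n powr (-x))"
    by (rule of_real_eq_iff[THEN iffD1])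
  thus ?thesis using infsum_nat_powr_le[OF assms] by (rule ord_eq_le_trans)
qed

section \<open>Zeros on the line of absolute convergence and the logarithm of L\<close>

lemma dirichlet_char_bounded_multiplicative:
  "dirichlet_char q \<psi> \<Longrightarrow> q > 0 \<Longrightarrow> bounded_multiplicative \<psi>"
  by unfold_locales (simp_all add: dirichlet_char_1 dirichlet_char_mult norm_dirichlet_char_le_1)

lemma dirichlet_L_eq_exp_log_series:
  assumes "dirichlet_char q \<psi>" "\<psi> \<noteq> principal_char q" "q > 0" "Re s > 1"
  shows "dirichlet_L q \<psi> s = exp (log_series \<psi> s)"
  using dirichlet_L_nonprincipal(2)[OF assms(1-3) assms(4)]
    bounded_multiplicative.exp_log_series_sums[OF dirichlet_char_bounded_multiplicative[OF assms(1,3)] assms(4)]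
  by (rule sums_unique2)

text \<open>A two-character analogue of the inequality for \<open>3 + 4 cos t + cos (2 t)\<close>.
  Termwise it holds because, for \<open>a\<close> and \<open>b\<close> of modulus at most 1,
  \<open>3 + 2 Re a + 2 Re b + 2 Re (a * cnj b)\<close> is at least
  \<open>|1 + a + b|^2\<close>.\<close>

lemma log_series_combination_nonneg:
  assumes f: "bounded_multiplicative f" and g: "bounded_multiplicative g" and x: "x > 1"
  shows "0 \<le> 3 * (\<Sum>\<^sub>\<infinity>i\<in>prime_pows. pp_weight x i) + 2 * Re (log_series f (Complex x t)) +
           2 * Re (log_series g (Complex x u)) + 2 * Re (log_series (\<lambda>n. f n * cnj (g n)) (Complex x (t - u)))"
proof -
  interpret f: bounded_multiplicative f by fact
  interpret g: bounded_multiplicative g by fact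
  interpret fg: bounded_multiplicative "\<lambda>n. f n * cnj (g n)"
    by standard (use f.norm_f g.norm_f in \<open>auto simp: f.f_1 g.f_1 f.f_mult g.f_mult norm_mult mult_le_one\<close>)
  define T where "T f s i = (case i of (p, k) \<Rightarrow> f (p ^ k) * of_nat (p ^ k) powr (-s) / of_nat k)"
    for f :: "nat \<Rightarrow> complex" and s and i :: "nat \<times> nat"
  have "((\<lambda>i. 3 * pp_weight x i + 2 * Re (T f (Complex x t) i) + 2 * Re (T g (Complex x u) i) +
           2 * Re (T (\<lambda>n. f n * cnj (g n)) (Complex x (t - u)) i)) has_sum
        (3 * (\<Sum>\<^sub>\<infinity>i\<in>prime_pows. pp_weight x i) + 2 * Re (log_series f (Complex x t)) +
           2 * Re (log_series g (Complex x u)) +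
           2 * Re (log_series (\<lambda>n. f n * cnj (g n)) (Complex x (t - u))))) prime_pows"
    unfolding log_series_def T_def using x
    by (intro has_sum_add has_sum_cmult_right has_sum_Re has_sum_infsum pp_weight_summable
          f.summable_log_series g.summable_log_series fg.summable_log_series) auto
  moreover have "3 * pp_weight x i + 2 * Re (T f (Complex x t) i) + 2 * Re (T g (Complex x u) i) +
           2 * Re (T (\<lambda>n. f n * cnj (g n)) (Complex x (t - u)) i) \<ge> 0" if "i \<in> prime_pows" for i
  proof -
    obtain p k where i: "i = (p, k)" by (cases i)
    define N where "N = p ^ k"
    have "p ^ k \<ge> 2" using prime_pows_ge_2 that i by blast
    hence N: "N > 0" unfolding N_def by linarith
    define w where "w = pp_weight x i"
    have w: "w \<ge> 0" by (simp add: w_def pp_weight_nonneg)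
    define z where "z f t = f N * of_nat N powr (- (\<i> * of_real t))" for f :: "nat \<Rightarrow> complex" and t
    have T: "T f (Complex x t) i = of_real w * z f t" for f t
    proof -
      have "of_nat N powr (- Complex x t) = of_nat N powr (- of_real x) * of_nat N powr (- (\<i> * of_real t))"
        by (simp add: Complex_eq powr_add[symmetric])
      also have "of_nat N powr (- of_real x) = complex_of_real (real N powr (-x))"
        using powr_of_real[of "real N" "-x"] by simp
      finally show ?thesis
        unfolding T_def i w_def pp_weight_def z_def prod.case N_def[symmetric] by simp
    qed
    have norm: "norm (of_nat N powr (- (\<i> * complex_of_real t))) = 1" for t
      using N by (subst norm_powr_real_powr) auto
    have "cnj (of_nat N powr (- (\<i> * complex_of_real u))) = of_nat N powr (\<i> * of_real u)"
      by (subst cnj_powr) auto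
    hence "z (\<lambda>n. f n * cnj (g n)) (t - u) = z f t * cnj (z g u)"
      by (simp add: z_def powr_add[symmetric] algebra_simps)
    moreover have "0 \<le> 3 + 2 * Re a + 2 * Re b + 2 * Re (a * cnj b)" if "norm a \<le> 1" "norm b \<le> 1" for a b
    proof -
      have "(Re a)\<^sup>2 + (Im a)\<^sup>2 \<le> 1" "(Re b)\<^sup>2 + (Im b)\<^sup>2 \<le> 1"
        using that by (simp_all add: cmod_def)
      moreover have "0 \<le> (1 + Re a + Re b)\<^sup>2 + (Im a + Im b)\<^sup>2" by simp
      ultimately show ?thesis by (simp add: power2_eq_square algebra_simps)
    qed
    moreover have "norm (z f t) \<le> 1" "norm (z g u) \<le> 1"
      using f.norm_f g.norm_f by (simp_all add: z_def norm_mult norm)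
    ultimately have "0 \<le> w * (3 + 2 * Re (z f t) + 2 * Re (z g u) + 2 * Re (z (\<lambda>n. f n * cnj (g n)) (t - u)))"
      using w by simp
    thus ?thesis unfolding T w_def[symmetric] by (simp add: algebra_simps)
  qed
  ultimately show ?thesis by (rule has_sum_nonneg)
qed

text \<open>
  Given two zeros on the line \<open>Re s = 1\<close>, the product
  \<open>\<zeta>(x)\<^sup>3 |L(x + it, \<psi>)|\<^sup>2 |L(x + iu, \<phi>)|\<^sup>2 |L(x + i(t - u), \<psi> cnj(\<phi>))|\<^sup>2\<close> has a zero of order at
  least \<open>4 - 3\<close> as \<open>x \<rightarrow> 1\<close>, although it is at least 1 for \<open>x > 1\<close>.
\<close>
lemma dirichlet_L_zero_on_1_line_unique:
  assumes \<psi>: "dirichlet_char q \<psi>" "\<psi> \<noteq> principal_char q"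
    and \<phi>: "dirichlet_char q \<phi>" "\<phi> \<noteq> principal_char q" and q: "q > 0"
    and zero: "dirichlet_L q \<psi> (Complex 1 t) = 0" "dirichlet_L q \<phi> (Complex 1 u) = 0"
  shows "\<psi> = \<phi>"
proof (rule ccontr)
  assume neq: "\<psi> \<noteq> \<phi>"
  define \<rho> where "\<rho> = (\<lambda>n. \<psi> n * cnj (\<phi> n))"
  have \<rho>: "dirichlet_char q \<rho>"
    unfolding \<rho>_def by (intro dirichlet_char_mult_char dirichlet_char_cnj \<psi> \<phi>)
  \<comment> \<open>Hence the L-function of \<open>\<rho>\<close> has no pole at
    \<open>1 + i(t - u)\<close>, even if \<open>t = u\<close>.\<close>
  have "\<rho> \<noteq> principal_char q"
  proof
    assume eq: "\<rho> = principal_char q"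
    have "\<psi> n = \<phi> n" for n
    proof (cases "coprime n q")
      case True
      have "\<psi> n * cnj (\<phi> n) = 1" "\<phi> n * cnj (\<phi> n) = 1"
        using fun_cong[OF eq, of n] dirichlet_char_mult_cnj[OF \<phi>(1) q, of n] True
        by (simp_all add: \<rho>_def principal_char_def)
      thus ?thesis by (metis mult_cancel_right zero_neq_one mult_zero_right)
    next
      case False
      thus ?thesis
        using dirichlet_char_eq_0_iff[OF \<psi>(1), of n] dirichlet_char_eq_0_iff[OF \<phi>(1), of n] by simp
    qed
    with neq show False by blast
  qed
  note \<rho> = \<rho> this
  have at: "filterlim (\<lambda>x. Complex x t) (at (Complex 1 t)) (at_right 1)" for t
    by (rule filterlim_atI)
       (auto intro!: tendsto_intros tendsto_eq_intros eventually_at_rightI[of 1 2] simp: Complex_eq)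
  have lim: "((\<lambda>x. norm (dirichlet_L q \<psi> (Complex x t)) / (x - 1)) \<longlongrightarrow> norm (deriv (dirichlet_L q \<psi>) (Complex 1 t))) (at_right 1)"
    if "dirichlet_char q \<psi>" "\<psi> \<noteq> principal_char q" "dirichlet_L q \<psi> (Complex 1 t) = 0" for \<psi> t
  proof -
    have "(dirichlet_L q \<psi> has_field_derivative deriv (dirichlet_L q \<psi>) (Complex 1 t)) (at (Complex 1 t))"
      by (rule holomorphic_derivI[OF dirichlet_L_nonprincipal(1)[OF that(1,2) q] open_halfspace_Re_gt]) simp
    hence "((\<lambda>z. dirichlet_L q \<psi> z / (z - Complex 1 t)) \<longlongrightarrow> deriv (dirichlet_L q \<psi>) (Complex 1 t)) (at (Complex 1 t))"
      using that(3) by (simp add: has_field_derivative_iff)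
    from tendsto_norm[OF filterlim_compose[OF this at]]
    have "((\<lambda>x. norm (dirichlet_L q \<psi> (Complex x t) / (Complex x t - Complex 1 t))) \<longlongrightarrow>
             norm (deriv (dirichlet_L q \<psi>) (Complex 1 t))) (at_right 1)" .
    moreover have "norm (dirichlet_L q \<psi> (Complex x t) / (Complex x t - Complex 1 t)) =
                     norm (dirichlet_L q \<psi> (Complex x t)) / (x - 1)" if "x > 1" for x
    proof -
      have "Complex x t - Complex 1 t = of_real (x - 1)" by (simp add: complex_eq_iff)
      thus ?thesis using that by (simp add: norm_divide del: of_real_diff)
    qed
    ultimately show ?thesis
      by (elim Lim_transform_eventually) (auto intro!: eventually_at_rightI[of 1 2])
  qed
  have lim_\<rho>: "((\<lambda>x. norm (dirichlet_L q \<rho> (Complex x (t - u)))) \<longlongrightarrow> norm (dirichlet_L q \<rho> (Complex 1 (t - u)))) (at_right 1)"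
  proof -
    have "continuous_on {s. Re s > 0} (dirichlet_L q \<rho>)"
      by (rule holomorphic_on_imp_continuous_on[OF dirichlet_L_nonprincipal(1)[OF \<rho> q]])
    hence "isCont (dirichlet_L q \<rho>) (Complex 1 (t - u))"
      by (simp add: continuous_on_eq_continuous_at open_halfspace_Re_gt)
    thus ?thesis
      by (intro tendsto_norm filterlim_compose[OF _ at]) (simp add: isCont_def)
  qed
  \<comment> \<open>Each of the two zeros absorbs \<open>(x - 1)^2\<close>, while
    \<open>\<zeta>(x)^3\<close> is at most \<open>8 / (x - 1)^3\<close> for \<open>x < 2\<close>;
    one factor \<open>x - 1\<close> is left over and forces the limit 0.\<close>
  define F where "F x = 8 * (norm (dirichlet_L q \<psi> (Complex x t)) / (x - 1))\<^sup>2 *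
      (norm (dirichlet_L q \<phi> (Complex x u)) / (x - 1))\<^sup>2 *
      (norm (dirichlet_L q \<rho> (Complex x (t - u))))\<^sup>2 * (x - 1)" for x
  have "(F \<longlongrightarrow> 8 * (norm (deriv (dirichlet_L q \<psi>) (Complex 1 t)))\<^sup>2 *
      (norm (deriv (dirichlet_L q \<phi>) (Complex 1 u)))\<^sup>2 *
      (norm (dirichlet_L q \<rho> (Complex 1 (t - u))))\<^sup>2 * (1 - 1)) (at_right 1)"
    unfolding F_def
    by (intro tendsto_mult tendsto_power tendsto_const tendsto_diff tendsto_ident_at lim[OF \<psi> zero(1)]
          lim[OF \<phi> zero(2)] lim_\<rho>)
  hence "(F \<longlongrightarrow> 0) (at_right 1)" by simp
  moreover have "\<forall>\<^sub>F x in at_right 1. F x \<ge> 1"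
  proof (rule eventually_at_rightI[of 1 2])
    fix x :: real assume "x \<in> {1<..<2}"
    hence x: "x > 1" "x < 2" by auto
    define Z where "Z = (\<Sum>\<^sub>\<infinity>i\<in>prime_pows. pp_weight x i)"
    have norm: "norm (dirichlet_L q \<psi> (Complex x t)) = exp (Re (log_series \<psi> (Complex x t)))"
      if "dirichlet_char q \<psi>" "\<psi> \<noteq> principal_char q" for \<psi> t
      using dirichlet_L_eq_exp_log_series[OF that q, of "Complex x t"] x by simp
    have "1 \<le> exp (3 * Z + 2 * Re (log_series \<psi> (Complex x t)) + 2 * Re (log_series \<phi> (Complex x u)) +
                2 * Re (log_series \<rho> (Complex x (t - u))))"
      using log_series_combination_nonneg[OF dirichlet_char_bounded_multiplicative[OF \<psi>(1) q]
          dirichlet_char_bounded_multiplicative[OF \<phi>(1) q] x(1), of t u]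
      unfolding Z_def \<rho>_def by simp
    also have "\<dots> = exp Z ^ 3 * (norm (dirichlet_L q \<psi> (Complex x t)))\<^sup>2 *
        (norm (dirichlet_L q \<phi> (Complex x u)))\<^sup>2 * (norm (dirichlet_L q \<rho> (Complex x (t - u))))\<^sup>2"
      unfolding norm[OF \<psi>] norm[OF \<phi>] norm[OF \<rho>] by (simp add: exp_add exp_of_nat_mult[symmetric] mult_ac)
    also have "\<dots> \<le> (2 / (x - 1)) ^ 3 * (norm (dirichlet_L q \<psi> (Complex x t)))\<^sup>2 *
        (norm (dirichlet_L q \<phi> (Complex x u)))\<^sup>2 * (norm (dirichlet_L q \<rho> (Complex x (t - u))))\<^sup>2"
    proof -
      have "exp Z \<le> x / (x - 1)"
        unfolding Z_def using exp_infsum_pp_weight_le x(1) .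
      also have "\<dots> \<le> 2 / (x - 1)" using x by (intro divide_right_mono) auto
      finally show ?thesis by (intro mult_right_mono power_mono) auto
    qed
    also have "\<dots> = F x"
      using x by (simp add: F_def power_divide power2_eq_square power3_eq_cube mult_ac)
    finally show "F x \<ge> 1" .
  qed simp
  ultimately have "(0::real) \<ge> 1"
    by (rule tendsto_lowerbound) simp
  thus False by simp
qed

text \<open>The half-plane is contractible, so \<open>L\<close> has a holomorphic logarithm there.
  On \<open>Re s > 1\<close> it differs from \<open>log_series\<close> by a constant
  \<open>c\<close> with \<open>exp c = 1\<close>; subtracting \<open>c\<close> gives a witness for
  the choice in \<open>log_dirichlet_L\<close>. The limit at infinity then makes the constant of the
  chosen function 0.\<close>

lemma log_dirichlet_L_nonprincipal:
  assumes \<psi>: "dirichlet_char q \<psi>" "\<psi> \<noteq> principal_char q" "q > 0"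
    and nz: "\<And>s. Re s > 1 / 2 \<Longrightarrow> dirichlet_L q \<psi> s \<noteq> 0"
  shows "log_dirichlet_L q \<psi> holomorphic_on {s. Re s > 1 / 2}"
    and "Re s > 1 / 2 \<Longrightarrow> exp (log_dirichlet_L q \<psi> s) = dirichlet_L q \<psi> s"
    and "Re s > 1 \<Longrightarrow> log_dirichlet_L q \<psi> s = log_series \<psi> s"
proof -
  interpret bounded_multiplicative \<psi> by (rule dirichlet_char_bounded_multiplicative[OF \<psi>(1,3)])
  define U where "U = {s. Re s > 1 / 2}"
  define V where "V = {s. Re s > 1}"
  have *: "\<exists>c. \<forall>s\<in>V. g s = log_series \<psi> s + c" 
    if g: "g holomorphic_on U" "\<And>s. s \<in> U \<Longrightarrow> exp (g s) = dirichlet_L q \<psi> s" for g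
  proof -
    have "(\<lambda>s. g s - log_series \<psi> s) constant_on V"
    proof (rule continuous_discrete_range_constant)
      show "connected V"
        unfolding V_def by (intro convex_connected convex_halfspace_Re_gt)
      show "continuous_on V (\<lambda>s. g s - log_series \<psi> s)"
        using continuous_on_log_series holomorphic_on_imp_continuous_on[OF g(1)]
        by (intro continuous_on_diff) (auto elim!: continuous_on_subset simp: U_def V_def)
      fix s assume s: "s \<in> V"
      have ex: "\<exists>n. g s - log_series \<psi> s = 2 * of_int n * of_real pi * \<i>" if "s \<in> V" for s
      proof -
        have "exp (g s) = exp (log_series \<psi> s)"
          using g(2)[of s] dirichlet_L_eq_exp_log_series[OF \<psi>, of s] that by (simp add: U_def V_def)
        thus ?thesis unfolding exp_eq by (auto simp: algebra_simps)
      qed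
      \<comment> \<open>Distinct integer multiples of \<open>2 \<pi> i\<close> are at least
        \<open>2 \<pi>\<close> apart, so the continuous difference has discrete range.\<close>
      have "1 \<le> norm (g y - log_series \<psi> y - (g s - log_series \<psi> s))"
        if y: "y \<in> V" "g y - log_series \<psi> y \<noteq> g s - log_series \<psi> s" for y
      proof -
        obtain m n where mn: "g s - log_series \<psi> s = 2 * of_int n * of_real pi * \<i>"
          "g y - log_series \<psi> y = 2 * of_int m * of_real pi * \<i>"
          using ex s y(1) by blast
        with y have "m \<noteq> n" by auto
        hence "1 \<le> \<bar>real_of_int (m - n)\<bar>" by linarith
        moreover have "g y - log_series \<psi> y - (g s - log_series \<psi> s) = of_real (2 * pi) * of_int (m - n) * \<i>"
          unfolding mn by (simp add: algebra_simps)
        hence "norm (g y - log_series \<psi> y - (g s - log_series \<psi> s)) = 2 * pi * \<bar>real_of_int (m - n)\<bar>"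
          by (simp only: norm_mult norm_of_real norm_of_int norm_ii) simp
        ultimately show ?thesis
          using pi_gt3 mult_mono[of 1 "2 * pi" 1 "\<bar>real_of_int (m - n)\<bar>"] by simp
      qed
      thus "\<exists>e>0. \<forall>y. y \<in> V \<and> g y - log_series \<psi> y \<noteq> g s - log_series \<psi> s \<longrightarrow>
              e \<le> norm (g y - log_series \<psi> y - (g s - log_series \<psi> s))"
        by (intro exI[of _ 1]) auto
    qed
    thus ?thesis unfolding constant_on_def by (metis diff_eq_eq add.commute)
  qed
  have lim: "((\<lambda>x::real. g (of_real x)) \<longlongrightarrow> c) at_top" if "\<And>s. s \<in> V \<Longrightarrow> g s = log_series \<psi> s + c" for g c
  proof -
    have "((\<lambda>x::real. log_series \<psi> (of_real x) + c) \<longlongrightarrow> 0 + c) at_top"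
      by (intro tendsto_intros log_series_tendsto_0)
    moreover have "\<forall>\<^sub>F x in at_top. log_series \<psi> (of_real x) + c = g (of_real x)"
      using eventually_gt_at_top[of 1] by eventually_elim (use that in \<open>auto simp: V_def\<close>)
    ultimately show ?thesis using Lim_transform_eventually by force
  qed
  have "dirichlet_L q \<psi> holomorphic_on U"
    by (rule holomorphic_on_subset[OF dirichlet_L_nonprincipal(1)[OF \<psi>]]) (auto simp: U_def)
  moreover have "contractible U"
    unfolding U_def by (intro convex_imp_contractible convex_halfspace_Re_gt)
  ultimately obtain g where g: "g holomorphic_on U" "\<And>s. s \<in> U \<Longrightarrow> dirichlet_L q \<psi> s = exp (g s)"
    using contractible_imp_holomorphic_log nz unfolding U_def by (metis mem_Collect_eq)
  obtain c where c: "\<And>s. s \<in> V \<Longrightarrow> g s = log_series \<psi> s + c"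
    using *[of g] g by auto
  have "exp c = 1"
  proof -
    have "2 \<in> U" "2 \<in> V" by (auto simp: U_def V_def)
    hence "exp (log_series \<psi> 2 + c) = exp (log_series \<psi> 2)"
      using g(2)[of 2] c[of 2] dirichlet_L_eq_exp_log_series[OF \<psi>, of 2] by simp
    thus ?thesis by (simp add: exp_add)
  qed
  hence "\<exists>g. g holomorphic_on {s. Re s > 1 / 2} \<and>
        (\<forall>s. Re s > 1 / 2 \<longrightarrow> exp (g s) = dirichlet_L q \<psi> s) \<and>
        ((\<lambda>x::real. g (of_real x)) \<longlongrightarrow> 0) at_top"
    using g lim[of "\<lambda>s. g s - c" 0] c
    by (intro exI[of _ "\<lambda>s. g s - c"]) (auto simp: U_def exp_diff intro!: holomorphic_intros)
  from someI_ex[OF this]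
  have G: "log_dirichlet_L q \<psi> holomorphic_on U"
    "\<And>s. s \<in> U \<Longrightarrow> exp (log_dirichlet_L q \<psi> s) = dirichlet_L q \<psi> s"
    "((\<lambda>x::real. log_dirichlet_L q \<psi> (of_real x)) \<longlongrightarrow> 0) at_top"
    unfolding log_dirichlet_L_def[symmetric] U_def by auto
  obtain d where d: "\<And>s. s \<in> V \<Longrightarrow> log_dirichlet_L q \<psi> s = log_series \<psi> s + d"
    using *[OF G(1,2)] by auto
  have "d = 0"
    using tendsto_unique[OF _ lim[OF d] G(3)] by simp
  show "log_dirichlet_L q \<psi> holomorphic_on {s. Re s > 1 / 2}"
    and "Re s > 1 / 2 \<Longrightarrow> exp (log_dirichlet_L q \<psi> s) = dirichlet_L q \<psi> s"
    and "Re s > 1 \<Longrightarrow> log_dirichlet_L q \<psi> s = log_series \<psi> s"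
    using G d \<open>d = 0\<close> by (auto simp: U_def V_def)
qed

section \<open>Taylor coefficients of the logarithm\<close>

text \<open>The map \<open>h / (2 A - h)\<close> sends the half-plane \<open>Re h < A\<close> into
  the unit disc and fixes 0. Schwarz's lemma applies to the composition, and solving for
  \<open>h\<close> gives the bound.\<close>

lemma borel_caratheodory:
  fixes f :: "complex \<Rightarrow> complex"
  assumes hol: "f holomorphic_on ball 0 R" and A: "A > 0"
    and Re_less: "\<And>z. norm z < R \<Longrightarrow> Re (f z - f 0) < A" and z: "norm z < R"
  shows "norm (f z - f 0) \<le> 2 * A * norm z / (R - norm z)"
proof -
  have R: "R > 0" using z norm_ge_zero[of z] by linarith
  define h where "h w = f (of_real R * w) - f 0" for w
  define \<phi> where "\<phi> w = h w / (2 * of_real A - h w)" for w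
  have mem: "norm (of_real R * w) < R" if "norm w < 1" for w :: complex
    using that R by (simp add: norm_mult)
  have Re_h: "Re (h w) < A" if "norm w < 1" for w
    unfolding h_def by (rule Re_less[OF mem[OF that]])
  have nz: "2 * of_real A - h w \<noteq> 0" if "norm w < 1" for w
  proof
    assume "2 * of_real A - h w = 0"
    hence "Re (2 * of_real A - h w) = 0" by simp
    thus False using Re_h[OF that] A by simp
  qed
  have "h holomorphic_on ball 0 1"
    unfolding h_def
    by (intro holomorphic_intros holomorphic_on_compose_gen[OF _ hol, unfolded o_def]) (use mem in auto)
  hence "\<phi> holomorphic_on ball 0 1"
    unfolding \<phi>_def by (intro holomorphic_intros) (use nz in auto)
  moreover have "norm (\<phi> w) < 1" if "norm w < 1" for w
  proof -
    \<comment> \<open>The difference of the two squares is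
      \<open>4 A (A - Re (h w))\<close>.\<close>
    have "(norm (h w))\<^sup>2 < (norm (2 * of_real A - h w))\<^sup>2"
      using mult_strict_left_mono[OF Re_h[OF that] A]
      unfolding cmod_power2 by (simp add: power2_eq_square algebra_simps)
    hence "norm (h w) < norm (2 * of_real A - h w)"
      by (rule power_less_imp_less_base) simp
    thus ?thesis by (simp add: \<phi>_def norm_divide divide_less_eq)
  qed
  moreover have "\<phi> 0 = 0" by (simp add: \<phi>_def h_def)
  ultimately have Schwarz: "norm (\<phi> w) \<le> norm w" if "norm w < 1" for w
    using Schwarz_Lemma(1)[of \<phi> w] that by blast
  define w where "w = z / of_real R"
  have w: "norm w < 1" using z R by (simp add: w_def norm_divide)
  have hw: "h w = f z - f 0" using R by (simp add: h_def w_def)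
  have "norm (h w) = norm (\<phi> w) * norm (2 * of_real A - h w)"
    using nz[OF w] by (simp add: \<phi>_def flip: norm_mult)
  also have "\<dots> \<le> norm w * (2 * A + norm (h w))"
    using A norm_triangle_ineq4[of "2 * of_real A" "h w"]
    by (intro mult_mono Schwarz w) (auto simp: norm_mult)
  finally have "norm (h w) * (1 - norm w) \<le> 2 * A * norm w"
    by (simp add: algebra_simps)
  hence "norm (h w) \<le> 2 * A * norm w / (1 - norm w)"
    using w by (simp add: pos_le_divide_eq)
  also have "\<dots> = 2 * A * norm z / (R - norm z)"
    using R z by (simp add: w_def norm_divide field_simps)
  finally show ?thesis by (simp only: hw)
qed

text \<open>An expansion known on the unit disc must be the Taylor series at 0, which converges on
  every disc of holomorphy and obeys Cauchy's inequality.\<close>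

lemma power_series_extend:
  fixes f :: "complex \<Rightarrow> complex"
  assumes hol: "f holomorphic_on ball 0 R" and r: "0 < r" "r < R"
    and B: "\<And>z. norm z \<le> r \<Longrightarrow> norm (f z) \<le> B"
    and a: "\<And>w. norm w < 1 \<Longrightarrow> (\<lambda>j. a j * w ^ j) sums f w"
  shows "norm (a j) \<le> B / r ^ j" and "norm w < R \<Longrightarrow> (\<lambda>j. a j * w ^ j) sums f w"
proof -
  have "f has_fps_expansion Abs_fps a"
    unfolding has_fps_expansion_def
  proof
    have "conv_radius a \<ge> 1"
    proof (rule conv_radius_geI_ex)
      fix s :: real assume "0 < s" "ereal s < 1"
      thus "\<exists>z. norm z = s \<and> summable (\<lambda>n. a n * z ^ n)"
        using a[of "of_real s"] by (intro exI[of _ "of_real s"]) (auto simp: sums_iff)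
    qed
    thus "fps_conv_radius (Abs_fps a) > 0" by (simp add: fps_conv_radius_def less_le_trans[of 0 "1::ereal"])
    have "\<forall>\<^sub>F z in nhds 0. z \<in> ball (0::complex) 1" by (intro eventually_nhds_in_open) auto
    thus "\<forall>\<^sub>F z in nhds 0. eval_fps (Abs_fps a) z = f z"
      by eventually_elim (use a in \<open>auto simp: eval_fps_def sums_iff\<close>)
  qed
  from fps_nth_fps_expansion[OF this] have coeff: "a j = (deriv ^^ j) f 0 / fact j" for j
    by simp
  show "(\<lambda>j. a j * w ^ j) sums f w" if "norm w < R"
    using holomorphic_power_series[OF hol, of w] that by (simp add: coeff)
  have sub: "cball 0 r \<subseteq> ball (0::complex) R" using r by auto
  have "norm ((deriv ^^ j) f 0) \<le> fact j * B / r ^ j"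
  proof (rule Cauchy_inequality)
    show "f holomorphic_on ball 0 r" by (rule holomorphic_on_subset[OF hol]) (use r in auto)
    show "continuous_on (cball 0 r) f"
      by (rule holomorphic_on_imp_continuous_on[OF holomorphic_on_subset[OF hol sub]])
  qed (use r B in auto)
  thus "norm (a j) \<le> B / r ^ j"
    by (simp add: coeff norm_divide divide_le_eq mult.commute)
qed

section \<open>Estimates for the exponential series\<close>

lemma power_div_fact_sums_exp: "(\<lambda>j. x ^ j / fact j) sums exp (x::real)"
  using exp_converges[of x] by (simp add: divide_inverse mult.commute)

lemma power_div_fact_le_exp:
  assumes "x \<ge> 0"
  shows "x ^ j / fact j \<le> exp (x::real)"
  using sum_le_suminf[OF sums_summable[OF power_div_fact_sums_exp[of x]], of "{j}"] assms
    sums_unique[OF power_div_fact_sums_exp[of x]] by simp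

text \<open>For \<open>j \<ge> J\<close> one has \<open>4 ^ J * x ^ j \<le> (4 * x) ^ j\<close>, so
  the tail is at most \<open>exp (4 * x) / 4 ^ J\<close>. Since \<open>ln 4 \<ge> 1\<close>, the
  bound on \<open>J\<close> gives \<open>4 ^ J \<ge> 4 * exp (3 * x)\<close>, and the tail is less
  than half of \<open>exp x\<close>.\<close>

lemma truncated_exp_ge_half:
  assumes "x \<ge> 0" "real J \<ge> 3 * x + 1"
  shows "(\<Sum>j<J. x ^ j / fact j) \<ge> exp x / (2::real)"
proof -
  have "4 ^ J * exp x \<le> 4 ^ J * (\<Sum>j<J. x ^ j / fact j) + exp (4 * x)"
  proof (rule sums_le)
    show "(\<lambda>j. 4 ^ J * (x ^ j / fact j)) sums (4 ^ J * exp x)"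
      by (intro sums_mult power_div_fact_sums_exp)
    have "(\<lambda>j. if j \<in> {..<J} then x ^ j / fact j else 0) sums (\<Sum>j<J. x ^ j / fact j)"
      by (rule sums_If_finite_set) auto
    thus "(\<lambda>j. 4 ^ J * (if j \<in> {..<J} then x ^ j / fact j else 0) + (4 * x) ^ j / fact j) sums
            (4 ^ J * (\<Sum>j<J. x ^ j / fact j) + exp (4 * x))"
      by (intro sums_add sums_mult power_div_fact_sums_exp)
    fix j
    have "(4::real) ^ J * x ^ j \<le> 4 ^ j * x ^ j" if "j \<ge> J"
      using that assms by (intro mult_right_mono power_increasing) auto
    hence "4 ^ J * (x ^ j / fact j) \<le> (4 * x) ^ j / fact j" if "j \<ge> J"
      using that by (simp add: power_mult_distrib divide_right_mono)
    thus "4 ^ J * (x ^ j / fact j) \<le>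
            4 ^ J * (if j \<in> {..<J} then x ^ j / fact j else 0) + (4 * x) ^ j / fact j"
      using assms by (auto simp: not_less)
  qed
  moreover have "2 * exp (4 * x) \<le> 4 ^ J * exp x"
  proof -
    have "exp (1::real) \<le> 3" by (rule exp_le)
    hence "1 \<le> ln (4::real)" by (subst ln_ge_iff) auto
    hence "3 * x + ln 4 \<le> (3 * x + 1) * ln 4"
      using assms(1) by (simp add: distrib_right mult_le_cancel_left1)
    also have "\<dots> \<le> real J * ln 4"
      using assms(2) by (intro mult_right_mono) auto
    finally have "exp (3 * x + ln 4) \<le> exp (real J * ln 4)" by simp
    hence "4 * exp (3 * x) \<le> 4 ^ J"
      by (simp add: exp_add exp_of_nat_mult)
    hence "2 * exp (3 * x) \<le> 4 ^ J" using exp_gt_zero[of "3 * x"] by linarith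
    hence "2 * exp (3 * x) * exp x \<le> 4 ^ J * exp x" by (rule mult_right_mono) simp
    moreover have "exp (3 * x) * exp x = exp (4 * x)" by (simp flip: exp_add)
    ultimately show ?thesis by (simp only: mult.assoc)
  qed
  ultimately have "4 ^ J * exp x \<le> 2 * (4 ^ J * (\<Sum>j<J. x ^ j / fact j))" by linarith
  thus ?thesis by simp
qed

section \<open>The Taylor expansion of \<open>log_series\<close> at 3\<close>

definition pp :: "nat \<times> nat \<Rightarrow> nat" where
  "pp = (\<lambda>(p, k). p ^ k)"

text \<open>The coefficient of \<open>a ^ j\<close> in \<open>pp_weight (3 - a) i\<close>, from
  \<open>n powr a = exp (a * ln n)\<close>.\<close>

definition taylor_weight :: "nat \<Rightarrow> nat \<times> nat \<Rightarrow> real" where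
  "taylor_weight j i = pp_weight 3 i * ln (pp i) ^ j / fact j"

lemma pp_ge_2: "i \<in> prime_pows \<Longrightarrow> pp i \<ge> 2"
  using prime_pows_ge_2[of "fst i" "snd i"] by (simp add: pp_def case_prod_unfold)

lemma pp_weight_eq: "pp_weight x i = real (pp i) powr (-x) / real (snd i)"
  by (simp add: pp_weight_def pp_def split: prod.splits)

lemma pp_weight_3_mult_pp:
  assumes "i \<in> prime_pows"
  shows "pp_weight 3 i * real (pp i) = pp_weight 2 i"
proof -
  have "real (pp i) powr (-3) * real (pp i) = real (pp i) powr (-2)"
    using pp_ge_2[OF assms] powr_add[of "real (pp i)" "-3" 1] by simp
  thus ?thesis by (simp add: pp_weight_eq)
qed

lemma ln_pp_nonneg: "i \<in> prime_pows \<Longrightarrow> ln (pp i) \<ge> 0"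
  using pp_ge_2[of i] by simp

lemma taylor_weight_nonneg: "i \<in> prime_pows \<Longrightarrow> taylor_weight j i \<ge> 0"
  using ln_pp_nonneg[of i] pp_weight_nonneg[of 3 i] by (simp add: taylor_weight_def)

text \<open>One power of \<open>n\<close> pays for \<open>(ln n) ^ j / j!\<close>, uniformly in
  \<open>j\<close>, and the exponent 2 that remains is still summable.\<close>

lemma taylor_weight_le:
  assumes "i \<in> prime_pows"
  shows "taylor_weight j i \<le> pp_weight 2 i"
proof -
  have "ln (pp i) ^ j / fact j \<le> real (pp i)"
    using power_div_fact_le_exp[OF ln_pp_nonneg[OF assms], of j] pp_ge_2[OF assms] by simp
  hence "pp_weight 3 i * (ln (pp i) ^ j / fact j) \<le> pp_weight 3 i * real (pp i)"
    by (rule mult_left_mono) (rule pp_weight_nonneg)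
  also have "\<dots> = pp_weight 2 i" by (rule pp_weight_3_mult_pp[OF assms])
  finally show ?thesis by (simp add: taylor_weight_def)
qed

text \<open>Stated for a general field because the real instance supplies the majorant and the
  complex one the expansion itself.\<close>

lemma taylor_weight_exp_has_sum:
  fixes z :: "'a :: {real_normed_field, banach}"
  shows "((\<lambda>j. of_real (taylor_weight j i) * z ^ j) has_sum
           (of_real (pp_weight 3 i) * exp (of_real (ln (pp i)) * z))) UNIV"
proof -
  have "summable (\<lambda>j. norm (of_real (ln (pp i)) * z) ^ j /\<^sub>R fact j)"
    by (rule summable_exp_generic)
  hence "((\<lambda>j. (of_real (ln (pp i)) * z) ^ j /\<^sub>R fact j) has_sum exp (of_real (ln (pp i)) * z)) UNIV"
    by (intro norm_summable_imp_has_sum exp_converges) (simp add: norm_power)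
  from has_sum_cmult_right[OF this, of "of_real (pp_weight 3 i)"] show ?thesis
    by (simp add: taylor_weight_def scaleR_conv_of_real power_mult_distrib divide_inverse mult_ac)
qed

context bounded_multiplicative
begin

text \<open>The sign comes from \<open>n powr (- w) = exp (- w * ln n)\<close>.\<close>

definition taylor_coeff :: "nat \<Rightarrow> complex" where
  "taylor_coeff j = (-1) ^ j * (\<Sum>\<^sub>\<infinity>i\<in>prime_pows. f (pp i) * of_real (taylor_weight j i))"

lemma norm_taylor_term_le:
  assumes "i \<in> prime_pows"
  shows "norm (f (pp i) * of_real (taylor_weight j i)) \<le> pp_weight 2 i"
proof -
  have "norm (f (pp i) * of_real (taylor_weight j i)) = norm (f (pp i)) * taylor_weight j i"
    using taylor_weight_nonneg[OF assms, of j] by (simp add: norm_mult)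
  also have "\<dots> \<le> taylor_weight j i"
    using norm_f taylor_weight_nonneg[OF assms] by (intro mult_left_le_one_le) auto
  also have "\<dots> \<le> pp_weight 2 i" by (rule taylor_weight_le[OF assms])
  finally show ?thesis .
qed

lemma taylor_coeff_has_sum:
  "((\<lambda>i. f (pp i) * of_real (taylor_weight j i)) has_sum ((-1) ^ j * taylor_coeff j)) prime_pows"
proof -
  have "(\<lambda>i. f (pp i) * of_real (taylor_weight j i)) summable_on prime_pows"
    by (rule abs_summable_summable[OF summable_on_comparison_test[OF pp_weight_summable[of 2]]])
       (use norm_taylor_term_le in auto)
  moreover have "(-1) ^ j * (-1) ^ j = (1 :: complex)"
    using power_mult_distrib[of "-1 :: complex" "-1" j] by simp
  hence "(-1) ^ j * taylor_coeff j = (\<Sum>\<^sub>\<infinity>i\<in>prime_pows. f (pp i) * of_real (taylor_weight j i))"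
    by (simp only: taylor_coeff_def mult.assoc[symmetric] mult_1)
  ultimately show ?thesis by (simp only: has_sum_infsum)
qed

text \<open>Each \<open>n powr (- w)\<close> is expanded and the double sum interchanged. It
  converges absolutely, since for \<open>norm w < 1\<close> the inner sums of absolute values are at
  most \<open>pp_weight 3 i * pp i = pp_weight 2 i\<close>.\<close>

lemma log_series_taylor:
  assumes w: "norm w < 1"
  shows "(\<lambda>j. taylor_coeff j * w ^ j) sums log_series f (3 + w)"
proof -
  define F where "F = (\<lambda>(i, j). f (pp i) * of_real (taylor_weight j i) * (- w) ^ j)"
  have "(\<lambda>(i, j). taylor_weight j i * norm w ^ j) summable_on prime_pows \<times> UNIV"
  proof (rule summable_on_SigmaI)
    show "((\<lambda>j. case (i, j) of (i, j) \<Rightarrow> taylor_weight j i * norm w ^ j) has_sum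
            (pp_weight 3 i * exp (ln (pp i) * norm w))) UNIV" for i
      using taylor_weight_exp_has_sum[of i "norm w"] by simp
    show "(\<lambda>i. pp_weight 3 i * exp (ln (pp i) * norm w)) summable_on prime_pows"
    proof (rule summable_on_comparison_test[OF pp_weight_summable[of 2]])
      fix i assume i: "i \<in> prime_pows"
      have "exp (ln (pp i) * norm w) \<le> exp (ln (pp i))"
        using ln_pp_nonneg[OF i] w by (simp add: mult_left_le)
      also have "\<dots> = real (pp i)" using pp_ge_2[OF i] by simp
      finally have "pp_weight 3 i * exp (ln (pp i) * norm w) \<le> pp_weight 3 i * real (pp i)"
        by (rule mult_left_mono) (rule pp_weight_nonneg)
      also have "\<dots> = pp_weight 2 i" by (rule pp_weight_3_mult_pp[OF i])
      finally show "pp_weight 3 i * exp (ln (pp i) * norm w) \<le> pp_weight 2 i" .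
    qed (auto simp: pp_weight_nonneg)
  qed (use taylor_weight_nonneg in auto)
  hence "(\<lambda>x. norm (F x)) summable_on prime_pows \<times> UNIV"
  proof (rule summable_on_comparison_test)
    fix x assume "x \<in> prime_pows \<times> (UNIV :: nat set)"
    then obtain i j where x: "x = (i, j)" "i \<in> prime_pows" by auto
    show "norm (F x) \<le> (case x of (i, j) \<Rightarrow> taylor_weight j i * norm w ^ j)"
      using norm_f[of "pp i"] taylor_weight_nonneg[OF x(2), of j]
      by (simp add: F_def x norm_mult norm_power mult_left_le_one_le mult_right_mono)
  qed auto
  hence "F summable_on prime_pows \<times> UNIV" by (rule abs_summable_summable)
  then obtain S where S: "(F has_sum S) (prime_pows \<times> UNIV)" by (auto simp: summable_on_def)
  \<comment> \<open>Summing over \<open>j\<close> first recovers \<open>log_series\<close>; summing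
    over \<open>i\<close> first, further below, gives the power series.\<close>
  have "((\<lambda>i. f (pp i) * (of_real (pp_weight 3 i) * exp (of_real (ln (pp i)) * (- w)))) has_sum S) prime_pows"
  proof (rule has_sum_SigmaD[OF S])
    fix i
    show "((\<lambda>j. F (i, j)) has_sum (f (pp i) * (of_real (pp_weight 3 i) * exp (of_real (ln (pp i)) * (- w))))) UNIV"
      using has_sum_cmult_right[OF taylor_weight_exp_has_sum[of i "- w"], of "f (pp i)"] by (simp add: F_def mult_ac)
  qed
  also have "?this \<longleftrightarrow> ((\<lambda>(p, k). f (p ^ k) * of_nat (p ^ k) powr (-(3 + w)) / of_nat k) has_sum S) prime_pows"
  proof (rule has_sum_cong)
    fix i assume i: "i \<in> prime_pows"
    have N: "pp i > 0" using pp_ge_2[OF i] by linarith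
    have "of_nat (pp i) powr (-(3 + w)) = of_nat (pp i) powr (- 3) * of_nat (pp i) powr (- w)"
      by (simp flip: powr_add)
    also have "of_nat (pp i) powr (- w) = exp (of_real (ln (pp i)) * (- w))"
      using N by (simp add: powr_def Ln_of_nat mult.commute)
    also have "of_nat (pp i) powr (- 3) = complex_of_real (real (pp i) powr (- 3))"
      using powr_of_real[of "real (pp i)" "-3"] by simp
    finally have eq: "of_nat (pp i) powr (-(3 + w)) =
        complex_of_real (real (pp i) powr (- 3)) * exp (of_real (ln (pp i)) * (- w))" .
    have "(case i of (p, k) \<Rightarrow> f (p ^ k) * of_nat (p ^ k) powr (-(3 + w)) / of_nat k) =
            f (pp i) * of_nat (pp i) powr (-(3 + w)) / of_nat (snd i)"
      by (simp only: pp_def case_prod_unfold)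
    thus "f (pp i) * (of_real (pp_weight 3 i) * exp (of_real (ln (pp i)) * (- w))) =
            (case i of (p, k) \<Rightarrow> f (p ^ k) * of_nat (p ^ k) powr (-(3 + w)) / of_nat k)"
      unfolding eq by (simp add: pp_weight_eq mult_ac)
  qed
  finally have "S = log_series f (3 + w)"
    unfolding log_series_def by (rule infsumI[symmetric])
  have "((\<lambda>(j, i). F (i, j)) has_sum S) (UNIV \<times> prime_pows)"
    using S by (subst (asm) has_sum_swap)
  hence "((\<lambda>j. taylor_coeff j * w ^ j) has_sum S) UNIV"
  proof (rule has_sum_SigmaD)
    fix j
    have eq: "(-1) ^ j * taylor_coeff j * (- w) ^ j = taylor_coeff j * w ^ j"
    proof -
      have "(-1) ^ j * (- w) ^ j = w ^ j" using power_mult_distrib[of "-1" "- w" j] by simp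
      moreover have "(-1) ^ j * taylor_coeff j * (- w) ^ j = taylor_coeff j * ((-1) ^ j * (- w) ^ j)"
        by (simp only: mult_ac)
      ultimately show ?thesis by (simp only:)
    qed
    thus "((\<lambda>i. case (j, i) of (j, i) \<Rightarrow> F (i, j)) has_sum (taylor_coeff j * w ^ j)) prime_pows"
      using has_sum_cmult_left[OF taylor_coeff_has_sum[of j], of "(- w) ^ j"] by (simp only: F_def prod.case eq)
  qed
  from has_sum_imp_sums[OF this] show ?thesis by (simp add: \<open>S = _\<close>)
qed

end

text \<open>\<open>pp_weight (3 - a) i\<close> with the exponential series cut off at degree
  \<open>J\<close>.\<close>

definition truncated_weight :: "nat \<Rightarrow> real \<Rightarrow> nat \<times> nat \<Rightarrow> real" where
  "truncated_weight J a i = (\<Sum>j<J. taylor_weight j i * a ^ j)"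

text \<open>Evaluation to the left of 3, at \<open>w = - a\<close>, cancels the signs of the Taylor
  coefficients. This is why the weights come out nonnegative for \<open>a \<ge> 0\<close>.\<close>

lemma (in bounded_multiplicative) truncated_weight_has_sum:
  "((\<lambda>i. f (pp i) * of_real (truncated_weight J a i)) has_sum (\<Sum>j<J. taylor_coeff j * of_real (- a) ^ j)) prime_pows"
proof (induction J)
  case (Suc J)
  have "(-1) ^ J * taylor_coeff J * of_real a ^ J = taylor_coeff J * of_real (- a) ^ J"
    using power_mult_distrib[of "-1" "complex_of_real a" J] by simp
  hence "((\<lambda>i. f (pp i) * of_real (taylor_weight J i) * of_real a ^ J) has_sum (taylor_coeff J * of_real (- a) ^ J)) prime_pows"
    using has_sum_cmult_left[OF taylor_coeff_has_sum[of J], of "of_real a ^ J"] by (simp only:)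
  from has_sum_add[OF Suc.IH this] show ?case
    by (simp add: truncated_weight_def algebra_simps)
qed (simp add: truncated_weight_def)

lemma truncated_weight_nonneg: "i \<in> prime_pows \<Longrightarrow> a \<ge> 0 \<Longrightarrow> truncated_weight J a i \<ge> 0"
  unfolding truncated_weight_def
  by (intro sum_nonneg mult_nonneg_nonneg taylor_weight_nonneg zero_le_power)

lemma truncated_weight_le:
  assumes "i \<in> prime_pows" "0 \<le> a" "a \<le> 3"
  shows "truncated_weight J a i \<le> 3 ^ J * pp_weight 2 i"
proof -
  have "truncated_weight J a i \<le> (\<Sum>j<J. pp_weight 2 i * 3 ^ j)"
    unfolding truncated_weight_def using assms
    by (intro sum_mono mult_mono taylor_weight_le power_mono) (auto simp: pp_weight_nonneg)
  also have "\<dots> = pp_weight 2 i * (\<Sum>j<J. 3 ^ j)" by (simp add: sum_distrib_left)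
  also have "(\<Sum>j<J. 3 ^ j) \<le> (3::real) ^ J"
  proof (induction J)
    case (Suc J)
    have "(\<Sum>j<Suc J. (3::real) ^ j) = (\<Sum>j<J. 3 ^ j) + 3 ^ J" "(3::real) ^ Suc J = 3 * 3 ^ J"
      "(0::real) \<le> 3 ^ J" by simp_all
    thus ?case using Suc by linarith
  qed simp
  hence "pp_weight 2 i * (\<Sum>j<J. 3 ^ j) \<le> pp_weight 2 i * 3 ^ J"
    by (rule mult_left_mono) (rule pp_weight_nonneg)
  finally show ?thesis by (simp only: mult.commute)
qed

lemma truncated_weight_prime_ge:
  assumes p: "prime p" and a: "0 \<le> a" and J: "real J \<ge> 3 * (a * ln p) + 1"
  shows "truncated_weight J a (p, 1) \<ge> real p powr (a - 3) / 2"
proof -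
  have p0: "p > 0" "ln (real p) \<ge> 0" using prime_gt_1_nat[OF p] by auto
  have "truncated_weight J a (p, 1) = real p powr (-3) * (\<Sum>j<J. (a * ln p) ^ j / fact j)"
    by (simp add: truncated_weight_def taylor_weight_def pp_weight_def pp_def sum_distrib_left power_mult_distrib mult_ac)
  also have "\<dots> \<ge> real p powr (-3) * (exp (a * ln p) / 2)"
    using p0 a J by (intro mult_left_mono truncated_exp_ge_half) auto
  also have "real p powr (-3) * (exp (a * ln p) / 2) = real p powr (a - 3) / 2"
    using p0 by (simp add: powr_def flip: exp_add) (simp add: algebra_simps)
  finally show ?thesis .
qed

section \<open>Chebyshev's lower bound\<close>

text \<open>By the two absorption identities, \<open>Suc k * (Suc n * (n choose Suc k))\<close>
  divides both \<open>Suc n * M\<close> and \<open>(n - k) * M\<close>, hence their difference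
  \<open>Suc k * M\<close>; then \<open>Suc k\<close> cancels.\<close>

lemma Suc_mult_binomial_dvd:
  assumes "k \<le> n" "\<And>m. 1 \<le> m \<Longrightarrow> m \<le> Suc n \<Longrightarrow> m dvd M"
  shows "Suc n * (n choose k) dvd M"
  using assms
proof (induction k arbitrary: n)
  case (Suc k)
  then obtain n' where n: "n = Suc n'" by (cases n) auto
  have absorb: "Suc k * (n choose Suc k) = n * (n' choose k)" "Suc k * (n choose Suc k) = (n - k) * (n choose k)"
    using binomial_absorption[of k n] binomial_absorb_comp[of n k] by (simp_all add: n)
  have "n * (n' choose k) dvd M" unfolding n
    by (rule Suc.IH) (use Suc.prems n in auto)
  hence "Suc n * (Suc k * (n choose Suc k)) dvd Suc n * M"
    unfolding absorb(1) by (rule mult_dvd_mono[OF dvd_refl])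
  hence 1: "Suc k * (Suc n * (n choose Suc k)) dvd Suc n * M" by (simp only: mult_ac)
  have "Suc n * (n choose k) dvd M"
    by (rule Suc.IH) (use Suc.prems in auto)
  hence "(n - k) * (Suc n * (n choose k)) dvd (n - k) * M"
    by (rule mult_dvd_mono[OF dvd_refl])
  hence "Suc n * (Suc k * (n choose Suc k)) dvd (n - k) * M"
    unfolding absorb(2) by (simp only: mult_ac)
  hence 2: "Suc k * (Suc n * (n choose Suc k)) dvd (n - k) * M" by (simp only: mult_ac)
  have "Suc n * M - (n - k) * M = Suc k * M"
  proof -
    have "Suc n - (n - k) = Suc k" using Suc.prems(1) by simp
    thus ?thesis by (simp only: diff_mult_distrib[symmetric])
  qed
  with dvd_diff_nat[OF 1 2] have "Suc k * (Suc n * (n choose Suc k)) dvd Suc k * M" by (simp only:)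
  thus ?case by (simp only: nat_mult_dvd_cancel_disj nat.simps simp_thms)
qed simp

text \<open>\<open>M\<close> is the least common multiple of the numbers up to \<open>N\<close>.
  Each of its prime powers is at most \<open>N\<close>, which bounds it above by
  \<open>N ^ card P\<close>; its multiple-of-binomial property bounds it below by the central
  binomial coefficient times \<open>2 * m + 1\<close>.\<close>

lemma card_primes_lower_bound_nat:
  assumes "m > 0"
  shows "4 ^ m \<le> (2 * m + 1) ^ card {p. prime p \<and> p \<le> 2 * m + 1}"
proof -
  define N where "N = 2 * m + 1"
  define P where "P = {p. prime p \<and> p \<le> N}"
  have finP: "finite P" by (simp add: P_def)
  define e where "e p = Max {k. p ^ k \<le> N}" for p
  have fin: "finite {k. p ^ k \<le> N}" if "p \<in> P" for p
  proof (rule finite_subset)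
    show "{k. p ^ k \<le> N} \<subseteq> {..N}"
    proof
      fix k assume k: "k \<in> {k. p ^ k \<le> N}"
      have "k < 2 ^ k" by (rule less_exp)
      also have "2 ^ k \<le> p ^ k"
        using that prime_ge_2_nat[of p] by (intro power_mono) (auto simp: P_def)
      also have "p ^ k \<le> N" using k by simp
      finally show "k \<in> {..N}" by simp
    qed
  qed simp
  have e: "p ^ e p \<le> N" "p ^ k \<le> N \<Longrightarrow> k \<le> e p" if "p \<in> P" for p k
  proof -
    have "e p \<in> {k. p ^ k \<le> N}"
      unfolding e_def using fin[OF that] by (intro Max_in) (auto intro!: exI[of _ 0] simp: N_def)
    thus "p ^ e p \<le> N" by simp
    show "p ^ k \<le> N \<Longrightarrow> k \<le> e p"
      unfolding e_def using fin[OF that] by (intro Max_ge) auto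
  qed
  define M where "M = (\<Prod>p\<in>P. p ^ e p)"
  have M: "M > 0" unfolding M_def by (intro prod_pos) (auto simp: P_def prime_gt_0_nat)
  have "j dvd M" if "1 \<le> j" "j \<le> N" for j
  proof (rule multiplicity_le_imp_dvd)
    show "j \<noteq> 0" using that by simp
    fix p :: nat assume p: "prime p"
    show "multiplicity p j \<le> multiplicity p M"
    proof (cases "p \<in> P")
      case True
      have "p ^ multiplicity p j \<le> j"
        using that by (intro dvd_imp_le multiplicity_dvd) auto
      hence "multiplicity p j \<le> e p" using e(2)[OF True] that by simp
      also have "\<dots> \<le> multiplicity p M"
        unfolding M_def by (subst multiplicity_prod_prime_powers) (use finP p True in \<open>auto simp: P_def\<close>)
      finally show ?thesis .
    next
      case False
      have "\<not> p dvd j"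
      proof
        assume "p dvd j"
        hence "p \<le> j" using that by (intro dvd_imp_le) auto
        thus False using False p that by (simp add: P_def)
      qed
      thus ?thesis by (simp add: not_dvd_imp_multiplicity_0)
    qed
  qed
  hence "Suc (2 * m) * (2 * m choose m) dvd M"
    by (intro Suc_mult_binomial_dvd) (auto simp: N_def)
  hence "Suc (2 * m) * (2 * m choose m) \<le> M" using M by (rule dvd_imp_le)
  also have "M \<le> (\<Prod>p\<in>P. N)"
    unfolding M_def by (intro prod_mono) (use e(1) in auto)
  finally have le: "Suc (2 * m) * (2 * m choose m) \<le> N ^ card P" by simp
  have "4 ^ m \<le> 2 * real m * real (2 * m choose m)"
    using central_binomial_lower_bound[OF assms] assms by (simp add: field_simps)
  also have "\<dots> \<le> real (Suc (2 * m) * (2 * m choose m))" by (simp add: algebra_simps)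
  finally have "real (4 ^ m) \<le> real (Suc (2 * m) * (2 * m choose m))" by simp
  hence "4 ^ m \<le> Suc (2 * m) * (2 * m choose m)" by (simp only: of_nat_le_iff)
  with le show ?thesis by (simp add: N_def P_def)
qed

lemma card_primes_lower_bound:
  assumes "y \<ge> 3"
  shows "(y - 3) * ln 2 \<le> real (card {p. prime p \<and> real p \<le> y}) * ln y"
proof -
  \<comment> \<open>Makes \<open>2 * m + 1\<close> an odd number in the interval from
    \<open>y - 2\<close> to \<open>y\<close>, so \<open>2 * m\<close> is at least
    \<open>y - 3\<close>.\<close>
  define m where "m = nat \<lfloor>(y - 1) / 2\<rfloor>"
  have m: "m > 0" "real (2 * m + 1) \<le> y" "y - 3 \<le> 2 * real m"
  proof -
    have "real m \<le> (y - 1) / 2" unfolding m_def using assms by (intro of_nat_floor) simp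
    moreover have "(y - 1) / 2 < real m + 1" unfolding m_def by linarith
    ultimately show "real (2 * m + 1) \<le> y" "y - 3 \<le> 2 * real m" by (simp_all add: field_simps)
    show "m > 0" using \<open>(y - 1) / 2 < real m + 1\<close> assms by (cases m) auto
  qed
  define n where "n = card {p. prime p \<and> p \<le> 2 * m + 1}"
  have fin: "finite {p::nat. prime p \<and> real p \<le> y}"
  proof (rule finite_subset)
    show "{p::nat. prime p \<and> real p \<le> y} \<subseteq> {..nat \<lfloor>y\<rfloor>}" by (auto simp: le_nat_floor)
  qed simp
  have "n \<le> card {p. prime p \<and> real p \<le> y}"
    unfolding n_def
  proof (intro card_mono fin subsetI)
    fix p assume "p \<in> {p. prime p \<and> p \<le> 2 * m + 1}"
    hence "prime p" "real p \<le> real (2 * m + 1)" by auto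
    thus "p \<in> {p. prime p \<and> real p \<le> y}" using m(2) by simp
  qed
  have "(4::nat) ^ m \<le> (2 * m + 1) ^ n"
    unfolding n_def by (rule card_primes_lower_bound_nat[OF m(1)])
  hence "real (4 ^ m) \<le> real ((2 * m + 1) ^ n)" by (simp only: of_nat_le_iff)
  hence "ln (4 ^ m) \<le> ln (real (2 * m + 1) ^ n)" by (subst ln_le_cancel_iff) auto
  hence "real m * ln 4 \<le> real n * ln (real (2 * m + 1))"
    by (simp add: ln_realpow)
  also have "\<dots> \<le> real n * ln y"
    using m by (intro mult_left_mono) auto
  also have "\<dots> \<le> real (card {p. prime p \<and> real p \<le> y}) * ln y"
    using \<open>n \<le> _\<close> assms by (intro mult_right_mono) auto
  finally have "real m * ln 4 \<le> real (card {p. prime p \<and> real p \<le> y}) * ln y" .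
  moreover have "real m * ln 4 = 2 * real m * ln 2"
    using ln_realpow[of 2 2] by simp
  moreover have "(y - 3) * ln 2 \<le> 2 * real m * ln 2"
    using m(3) by (intro mult_right_mono) auto
  ultimately show ?thesis by linarith
qed

section \<open>Approximation of the logarithm of L by its Taylor polynomial\<close>

text \<open>\<open>GRH\<close> speaks only of \<open>0 < Re s < 1\<close>. Adding the line
  \<open>Re s = 1\<close> gives a zero-free half-plane \<open>Re s > 1 / 2\<close>.\<close>

definition good_char :: "nat \<Rightarrow> (nat \<Rightarrow> complex) \<Rightarrow> bool" where
  "good_char q \<psi> \<longleftrightarrow> dirichlet_char q \<psi> \<and> \<psi> \<noteq> principal_char q \<and> (\<forall>t. dirichlet_L q \<psi> (Complex 1 t) \<noteq> 0)"

lemma card_not_good_char: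
  assumes "q > 0"
  shows "card ({\<psi>. dirichlet_char q \<psi>} - {\<psi>. good_char q \<psi>}) \<le> 2"
proof -
  define B where "B = {\<psi>. dirichlet_char q \<psi> \<and> \<psi> \<noteq> principal_char q \<and> (\<exists>t. dirichlet_L q \<psi> (Complex 1 t) = 0)}"
  have "\<exists>\<phi>. B \<subseteq> {\<phi>}"
    using dirichlet_L_zero_on_1_line_unique[OF _ _ _ _ assms] unfolding B_def by blast
  then obtain \<phi> where "B \<subseteq> {\<phi>}" by blast
  hence "{\<psi>. dirichlet_char q \<psi>} - {\<psi>. good_char q \<psi>} \<subseteq> {principal_char q, \<phi>}"
    by (auto simp: B_def good_char_def)
  from card_mono[OF _ this] show ?thesis
    by (simp add: card_insert_if split: if_splits)
qed

lemma good_char_nonzero: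
  assumes "GRH" "good_char q \<psi>" "q > 0" "Re s > 1 / 2"
  shows "dirichlet_L q \<psi> s \<noteq> 0"
proof -
  have \<psi>: "dirichlet_char q \<psi>" "\<psi> \<noteq> principal_char q" using assms(2) by (auto simp: good_char_def)
  consider "Re s < 1" | "Re s = 1" | "Re s > 1" by linarith
  thus ?thesis
  proof cases
    case 1
    show ?thesis
    proof
      assume "dirichlet_L q \<psi> s = 0"
      moreover have "0 < Re s" using assms(4) by linarith
      ultimately have "Re s = 1 / 2"
        using assms(1,3) \<psi>(1) 1 unfolding GRH_def by blast
      thus False using assms(4) by simp
    qed
  next
    case 2
    hence "s = Complex 1 (Im s)" by (simp add: complex_eq_iff)
    thus ?thesis using assms(2) unfolding good_char_def by metis
  next
    case 3
    thus ?thesis using dirichlet_L_eq_exp_log_series[OF \<psi> assms(3)] by simp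
  qed
qed

text \<open>For a character this is the Taylor polynomial of its \<open>log_series\<close> at 3, of
  degree below \<open>J\<close>, evaluated at \<open>3 - a\<close>.\<close>

definition short_sum :: "nat \<Rightarrow> real \<Rightarrow> (nat \<Rightarrow> complex) \<Rightarrow> complex" where
  "short_sum J a f = (\<Sum>\<^sub>\<infinity>i\<in>prime_pows. f (pp i) * of_real (truncated_weight J a i))"

text \<open>The disc of radius \<open>5 / 2\<close> about 3 reaches exactly to
  \<open>Re s = 1 / 2\<close> and contains \<open>\<sigma>\<close>. Borel-Caratheodory bounds
  \<open>log L\<close> by a multiple of \<open>ln q\<close> on a smaller disc of radius
  \<open>r\<close>; Cauchy's inequality then gives a geometric tail of ratio
  \<open>\<rho> = (3 - \<sigma>) / r\<close>.\<close>

lemma log_dirichlet_L_approx: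
  assumes GRH and \<sigma>: "1 / 2 < \<sigma>" "\<sigma> < 1"
  obtains K \<rho> where "0 < K" "0 < \<rho>" "\<rho> < 1"
    "\<And>q \<psi> J. q \<ge> 3 \<Longrightarrow> good_char q \<psi> \<Longrightarrow>
       norm (log_dirichlet_L q \<psi> (of_real \<sigma>) - short_sum J (3 - \<sigma>) \<psi>) \<le> K * ln (real q) * \<rho> ^ J"
proof -
  define C0 where "C0 = (\<Sum>\<^sub>\<infinity>i\<in>prime_pows. pp_weight 3 i)"
  \<comment> \<open>The constant in the bound for \<open>L\<close> with
    \<open>\<delta> = 1 / 2\<close>. The factor 11 next to it is \<open>2 * (11 / 2)\<close>, as
    points of the disc have modulus at most \<open>11 / 2\<close>.\<close>
  define S where "S = (\<Sum>n. real (Suc n) powr (- (1 / 2) - 1))"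
  define C1 where "C1 = \<bar>ln (11 * S)\<bar> + C0 + 1"
  \<comment> \<open>Midway between \<open>3 - \<sigma>\<close> and \<open>5 / 2\<close>: beyond
    \<open>\<sigma>\<close>, but strictly inside the disc of holomorphy.\<close>
  define r where "r = (5 / 2 + (3 - \<sigma>)) / 2"
  define \<rho> where "\<rho> = (3 - \<sigma>) / r"
  define K1 where "K1 = 2 * (1 + C1) * r / (5 / 2 - r) + C0"
  define K where "K = K1 / (1 - \<rho>)"
  have r: "0 < r" "r < 5 / 2" "3 - \<sigma> < r" using \<sigma> by (auto simp: r_def)
  have \<rho>: "0 < \<rho>" "\<rho> < 1" using r \<sigma> by (auto simp: \<rho>_def)
  have C0: "C0 \<ge> 0" unfolding C0_def by (intro infsum_nonneg pp_weight_nonneg)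
  have S: "S > 0"
    unfolding S_def by (intro suminf_pos summable_Suc_powr) auto
  have C1: "C1 > 0" using C0 by (simp add: C1_def)
  have "2 * (1 + C1) * r / (5 / 2 - r) > 0" using r C1 by simp
  hence K1: "K1 > 0" using C0 by (simp add: K1_def)
  have main: "norm (log_dirichlet_L q \<psi> (of_real \<sigma>) - short_sum J (3 - \<sigma>) \<psi>) \<le> K * ln (real q) * \<rho> ^ J"
    if q: "q \<ge> 3" and good: "good_char q \<psi>" for q \<psi> J
  proof -
    have \<psi>: "dirichlet_char q \<psi>" "\<psi> \<noteq> principal_char q" "q > 0"
      using good q by (auto simp: good_char_def)
    interpret bounded_multiplicative \<psi> by (rule dirichlet_char_bounded_multiplicative[OF \<psi>(1,3)])
    note nz = good_char_nonzero[OF \<open>GRH\<close> good \<psi>(3)]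
    have log: "log_dirichlet_L q \<psi> holomorphic_on {s. Re s > 1 / 2}"
      "Re s > 1 / 2 \<Longrightarrow> exp (log_dirichlet_L q \<psi> s) = dirichlet_L q \<psi> s"
      "Re s > 1 \<Longrightarrow> log_dirichlet_L q \<psi> s = log_series \<psi> s" for s
      by (rule log_dirichlet_L_nonprincipal[OF \<psi>]; use nz in blast)+
    have "ln (real q) \<ge> ln (exp 1)"
      using q exp_le by (subst ln_le_cancel_iff) auto
    hence lnq: "ln (real q) \<ge> 1" by simp
    define f where "f w = log_dirichlet_L q \<psi> (3 + w)" for w
    have Re_gt: "Re (3 + w) > 1 / 2" if "norm w < 5 / 2" for w
      using that abs_Re_le_cmod[of w] by simp
    have hol: "f holomorphic_on ball 0 (5 / 2)"
      unfolding f_def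
    proof (rule holomorphic_on_compose_gen[OF _ log(1), unfolded o_def])
      show "(\<lambda>w. 3 + w) ` ball 0 (5 / 2) \<subseteq> {s. 1 / 2 < Re s}"
        by (rule image_subsetI) (use Re_gt in simp)
    qed (intro holomorphic_intros)
    have f0: "norm (f 0) \<le> C0"
      unfolding f_def C0_def using log(3)[of 3] norm_log_series_le[of 3 3] by simp
    define A where "A = ln (real q) + C1"
    have A: "A > 0" "A \<le> (1 + C1) * ln (real q)"
      using lnq C1 mult_left_mono[OF lnq, of C1] by (auto simp: A_def algebra_simps)
    have Re_less: "Re (f w - f 0) < A" if w: "norm w < 5 / 2" for w
    proof -
      have "norm (3 + w) \<le> 11 / 2"
        using norm_triangle_ineq[of 3 w] w by simp
      hence "2 * real q * norm (3 + w) * S \<le> 2 * real q * (11 / 2) * S"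
        using S by (intro mult_right_mono mult_left_mono) auto
      moreover have "norm (dirichlet_L q \<psi> (3 + w)) \<le> 2 * real q * norm (3 + w) * S"
        unfolding S_def using Re_gt[OF w] by (intro norm_dirichlet_L_nonprincipal_le \<psi>) auto
      moreover have "norm (dirichlet_L q \<psi> (3 + w)) = exp (Re (f w))"
        using log(2)[OF Re_gt[OF w]] by (simp add: f_def flip: norm_exp_eq_Re)
      ultimately have "exp (Re (f w)) \<le> real q * (11 * S)" by simp
      hence "Re (f w) \<le> ln (real q * (11 * S))"
        using S \<psi>(3) by (subst ln_ge_iff) auto
      also have "\<dots> = ln (real q) + ln (11 * S)"
        using S \<psi>(3) by (subst ln_mult) auto
      finally have "Re (f w) \<le> ln (real q) + \<bar>ln (11 * S)\<bar>" by linarith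
      moreover have "\<bar>Re (f 0)\<bar> \<le> C0" using f0 abs_Re_le_cmod[of "f 0"] by linarith
      ultimately show ?thesis by (simp add: A_def C1_def)
    qed
    have bound: "norm (f w) \<le> K1 * ln (real q)" if w: "norm w \<le> r" for w
    proof -
      have "norm (f w - f 0) \<le> 2 * A * norm w / (5 / 2 - norm w)"
        using w r by (intro borel_caratheodory[OF hol A(1)] Re_less) auto
      also have "\<dots> \<le> 2 * A * r / (5 / 2 - r)"
        using w r A by (intro frac_le mult_left_mono) auto
      also have "\<dots> \<le> 2 * ((1 + C1) * ln (real q)) * r / (5 / 2 - r)"
        using A(2) r by (intro divide_right_mono mult_right_mono mult_left_mono) auto
      also have "\<dots> = 2 * (1 + C1) * r / (5 / 2 - r) * ln (real q)"
        by (simp only: times_divide_eq_left times_divide_eq_right mult_ac)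
      finally have "norm (f w - f 0) \<le> 2 * (1 + C1) * r / (5 / 2 - r) * ln (real q)" .
      moreover have "C0 \<le> C0 * ln (real q)" using C0 lnq by (simp add: mult_le_cancel_left1)
      ultimately show ?thesis
        using f0 norm_triangle_sub[of "f w" "f 0"] by (simp add: K1_def distrib_right)
    qed
    have sums: "(\<lambda>j. taylor_coeff j * w ^ j) sums f w" if "norm w < 1" for w
      using log_series_taylor[OF that] log(3)[of "3 + w"] that abs_Re_le_cmod[of w] by (simp add: f_def)
    note ext = power_series_extend[OF hol r(1,2) bound sums]
    define w where "w = complex_of_real (- (3 - \<sigma>))"
    have normw: "norm w = 3 - \<sigma>" using \<sigma> unfolding w_def norm_of_real by simp
    have "(\<lambda>j. taylor_coeff j * w ^ j) sums f w"
      using normw r by (intro ext(2)) auto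
    hence tail: "(\<lambda>j. taylor_coeff (j + J) * w ^ (j + J)) sums (f w - (\<Sum>j<J. taylor_coeff j * w ^ j))"
      by (rule sums_split_initial_segment)
    have geom: "(\<lambda>j. K1 * ln (real q) * \<rho> ^ J * \<rho> ^ j) sums (K1 * ln (real q) * \<rho> ^ J * (1 / (1 - \<rho>)))"
      using \<rho> by (intro sums_mult geometric_sums) auto
    have le: "norm (taylor_coeff (j + J) * w ^ (j + J)) \<le> K1 * ln (real q) * \<rho> ^ J * \<rho> ^ j" for j
    proof -
      have "norm (taylor_coeff (j + J) * w ^ (j + J)) \<le> K1 * ln (real q) / r ^ (j + J) * (3 - \<sigma>) ^ (j + J)"
        unfolding norm_mult norm_power normw using \<sigma> by (intro mult_right_mono ext(1)) auto
      also have "\<dots> = K1 * ln (real q) * \<rho> ^ J * \<rho> ^ j"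
        by (simp add: \<rho>_def power_divide power_add mult_ac)
      finally show ?thesis .
    qed
    have "norm (f w - (\<Sum>j<J. taylor_coeff j * w ^ j)) \<le> K1 * ln (real q) * \<rho> ^ J * (1 / (1 - \<rho>))"
      using norm_sums_le[OF tail geom le] .
    moreover have "(\<Sum>j<J. taylor_coeff j * w ^ j) = short_sum J (3 - \<sigma>) \<psi>"
      unfolding short_sum_def w_def by (rule infsumI[OF truncated_weight_has_sum, symmetric])
    moreover have "f w = log_dirichlet_L q \<psi> (of_real \<sigma>)"
      by (simp add: f_def w_def)
    ultimately show ?thesis by (simp add: K_def)
  qed
  show ?thesis
    using that[of K \<rho>] main K1 \<rho> by (simp add: K_def)
qed

section \<open>The resonance inequality\<close>

lemma has_sum_finite_sum:
  fixes f :: "'a \<Rightarrow> 'b \<Rightarrow> 'c :: topological_comm_monoid_add"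
  assumes "\<And>x. x \<in> X \<Longrightarrow> (f x has_sum s x) A"
  shows "((\<lambda>i. \<Sum>x\<in>X. f x i) has_sum (\<Sum>x\<in>X. s x)) A"
  using assms by (induction X rule: infinite_finite_induct) (auto intro: has_sum_add)

text \<open>A crude bound, applied to the characters that are not good.\<close>

lemma norm_short_sum_le:
  assumes "bounded_multiplicative f" "0 \<le> a" "a \<le> 3"
  shows "norm (short_sum J a f) \<le> 3 ^ J * (\<Sum>\<^sub>\<infinity>i\<in>prime_pows. pp_weight 2 i)"
proof -
  interpret bounded_multiplicative f by fact
  have 2: "((\<lambda>i. 3 ^ J * pp_weight 2 i) has_sum (3 ^ J * (\<Sum>\<^sub>\<infinity>i\<in>prime_pows. pp_weight 2 i))) prime_pows"
    by (intro has_sum_cmult_right has_sum_infsum pp_weight_summable) simp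
  have 1: "((\<lambda>i. f (pp i) * of_real (truncated_weight J a i)) has_sum short_sum J a f) prime_pows"
    unfolding short_sum_def by (rule has_sum_infsum[OF has_sum_imp_summable[OF truncated_weight_has_sum]])
  show ?thesis
  proof (rule norm_infsum_le[OF 1 2])
    fix i assume i: "i \<in> prime_pows"
    have "norm (f (pp i) * of_real (truncated_weight J a i)) = norm (f (pp i)) * truncated_weight J a i"
      using truncated_weight_nonneg[OF i assms(2), of J] by (simp add: norm_mult)
    also have "\<dots> \<le> truncated_weight J a i"
      using truncated_weight_nonneg[OF i assms(2)] norm_f by (intro mult_left_le_one_le) auto
    also have "\<dots> \<le> 3 ^ J * pp_weight 2 i"
      by (rule truncated_weight_le[OF i assms(2,3)])
    finally show "norm (f (pp i) * of_real (truncated_weight J a i)) \<le> 3 ^ J * pp_weight 2 i" .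
  qed
qed

text \<open>Compares two estimates of the weighted sum of
  \<open>Re (exp (- \<i> * \<theta>) * short_sum J a \<psi>)\<close> over all characters. From
  below, positivity leaves the primes of \<open>P\<close>; from above, good characters contribute at
  most \<open>V\<close> times their weight and at most two others are bounded crudely. Division by
  the total weight \<open>T \<ge> q - 1\<close> finishes.\<close>

lemma resonance_inequality:
  assumes q: "prime q" "q > 2" and P: "finite P" "\<And>p. p \<in> P \<Longrightarrow> prime p" "\<And>p. p \<in> P \<Longrightarrow> coprime p q"
    and a: "0 \<le> a" "a \<le> 3" and cos: "cos \<theta> \<ge> 0" and V: "V \<ge> 0"
    and le_V: "\<And>\<psi>. good_char q \<psi> \<Longrightarrow> Re (exp (- \<i> * of_real \<theta>) * short_sum J a \<psi>) \<le> V"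
  shows "cos \<theta> * ((\<Sum>p\<in>P. truncated_weight J a (p, 1)) / 2) \<le>
           V + 2 * 4 ^ card P * (3 ^ J * (\<Sum>\<^sub>\<infinity>i\<in>prime_pows. pp_weight 2 i)) / (real q - 1)"
proof -
  define X where "X = {\<psi>. dirichlet_char q \<psi>}"
  define G where "G = {\<psi>. good_char q \<psi>}"
  define W where "W = resonance P"
  define T where "T = (\<Sum>\<psi>\<in>X. W \<psi>)"
  define C where "C = 3 ^ J * (\<Sum>\<^sub>\<infinity>i\<in>prime_pows. pp_weight 2 i)"
  define z where "z = exp (- \<i> * of_real \<theta>)"
  define S where "S = (\<Sum>\<psi>\<in>X. of_real (W \<psi>) * short_sum J a \<psi>)"
  have q0: "q > 0" using q by simp
  have finX: "finite X" unfolding X_def by (rule finite_dirichlet_chars[OF q0])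
  have GX: "G \<subseteq> X" by (auto simp: G_def X_def good_char_def)
  have bm: "bounded_multiplicative \<psi>" if "\<psi> \<in> X" for \<psi>
    using that q0 by (auto simp: X_def intro: dirichlet_char_bounded_multiplicative)
  have W: "0 \<le> W \<psi>" "W \<psi> \<le> 4 ^ card P" if "\<psi> \<in> X" for \<psi>
    using resonance_bounds[OF _ q0] that by (auto simp: X_def W_def)
  have T: "T \<ge> real q - 1"
    using sum_resonance_ge[OF P(1) q0] card_dirichlet_chars_ge[OF q] q unfolding T_def X_def W_def by linarith
  have C: "C \<ge> 0" unfolding C_def by (intro mult_nonneg_nonneg infsum_nonneg pp_weight_nonneg) auto
  have norm_z: "norm z = 1" by (simp add: z_def)
  have Re_z: "Re z = cos \<theta>" by (simp add: z_def Re_exp)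

  \<comment> \<open>The finite sum over characters is moved inside the sum over prime
    powers.\<close>
  have S: "((\<lambda>i. res_corr q P (pp i) 1 * of_real (truncated_weight J a i)) has_sum S) prime_pows"
  proof -
    have "((\<lambda>i. \<Sum>\<psi>\<in>X. of_real (W \<psi>) * (\<psi> (pp i) * of_real (truncated_weight J a i))) has_sum S) prime_pows"
      unfolding S_def short_sum_def
      by (intro has_sum_finite_sum has_sum_cmult_right has_sum_infsum
            has_sum_imp_summable[OF bounded_multiplicative.truncated_weight_has_sum[OF bm]])
    moreover have "(\<Sum>\<psi>\<in>X. of_real (W \<psi>) * (\<psi> (pp i) * of_real (truncated_weight J a i))) =
                     res_corr q P (pp i) 1 * of_real (truncated_weight J a i)" for i
      unfolding res_corr_def X_def[symmetric] W_def[symmetric] sum_distrib_right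
      by (intro sum.cong) (auto simp: X_def dirichlet_char_1)
    ultimately show ?thesis by simp
  qed
  have corr: "Re (res_corr q P m n) \<ge> 0" "Im (res_corr q P m n) = 0" for m n
    using res_corr_nonneg[OF P(1) q0, of m n] by (auto simp: complex_nonneg_Reals_iff)
  have "((\<lambda>i. Im (res_corr q P (pp i) 1 * of_real (truncated_weight J a i))) has_sum Im S) prime_pows"
    using S by (rule has_sum_Im)
  \<comment> \<open>Real correlations make \<open>S\<close> real, so rotation by
    \<open>\<theta>\<close> only multiplies its real part by \<open>cos \<theta>\<close>.\<close>
  hence "Im S = 0" using infsumI by (fastforce simp: corr)
  \<comment> \<open>All terms are nonnegative, so everything except the primes of \<open>P\<close>
    may be dropped.\<close>
  have "(\<Sum>i\<in>(\<lambda>p. (p, 1)) ` P. Re (res_corr q P (pp i) 1 * of_real (truncated_weight J a i))) \<le> Re S"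
  proof (rule finite_sum_le_has_sum[OF has_sum_Re[OF S]])
    show "(\<lambda>p. (p, 1)) ` P \<subseteq> prime_pows" using P(2) by (auto simp: prime_pows_def)
  qed (use P(1) corr truncated_weight_nonneg[OF _ a(1)] in auto)
  moreover have "(\<Sum>p\<in>P. T / 2 * truncated_weight J a (p, 1)) \<le>
      (\<Sum>i\<in>(\<lambda>p. (p, 1)) ` P. Re (res_corr q P (pp i) 1 * of_real (truncated_weight J a i)))"
  proof (subst sum.reindex)
    show "(\<Sum>p\<in>P. T / 2 * truncated_weight J a (p, 1)) \<le>
            sum ((\<lambda>i. Re (res_corr q P (pp i) 1 * of_real (truncated_weight J a i))) \<circ> (\<lambda>p. (p, 1))) P"
    proof (rule sum_mono)
      fix p assume p: "p \<in> P"
      have "(p, 1) \<in> prime_pows" using P(2)[OF p] by (simp add: prime_pows_def)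
      from truncated_weight_nonneg[OF this a(1), of J]
      have "T / 2 * truncated_weight J a (p, 1) \<le> Re (res_corr q P p 1) * truncated_weight J a (p, 1)"
        using res_corr_ge_half[OF P(1) q0 p P(3)[OF p]] unfolding T_def X_def W_def
        by (intro mult_right_mono)
      thus "T / 2 * truncated_weight J a (p, 1) \<le>
          ((\<lambda>i. Re (res_corr q P (pp i) 1 * of_real (truncated_weight J a i))) \<circ> (\<lambda>p. (p, 1))) p"
        by (simp add: pp_def)
    qed
  qed (auto simp: inj_on_def)
  ultimately have "(\<Sum>p\<in>P. T / 2 * truncated_weight J a (p, 1)) \<le> Re S"
    by (rule order_trans[rotated])
  hence Re_S: "T * ((\<Sum>p\<in>P. truncated_weight J a (p, 1)) / 2) \<le> Re S"
    by (simp add: sum_distrib_left sum_divide_distrib)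

  have "cos \<theta> * Re S = Re (z * S)"
    using \<open>Im S = 0\<close> Re_z by simp
  also have "\<dots> = (\<Sum>\<psi>\<in>X. W \<psi> * Re (z * short_sum J a \<psi>))"
  proof -
    have "z * S = (\<Sum>\<psi>\<in>X. of_real (W \<psi>) * (z * short_sum J a \<psi>))"
      by (simp add: S_def sum_distrib_left mult_ac)
    thus ?thesis by (simp add: Re_sum)
  qed
  also have "\<dots> = (\<Sum>\<psi>\<in>G. W \<psi> * Re (z * short_sum J a \<psi>)) + (\<Sum>\<psi>\<in>X - G. W \<psi> * Re (z * short_sum J a \<psi>))"
    using sum.subset_diff[OF GX finX] by (simp add: add.commute)
  also have "\<dots> \<le> T * V + 2 * (4 ^ card P * C)"
  proof (rule add_mono)
    have "(\<Sum>\<psi>\<in>G. W \<psi> * Re (z * short_sum J a \<psi>)) \<le> (\<Sum>\<psi>\<in>G. W \<psi> * V)"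
      using GX W(1) le_V by (intro sum_mono mult_left_mono) (auto simp: G_def z_def)
    \<comment> \<open>Extending the sum from \<open>G\<close> to \<open>X\<close> relies on
      \<open>V \<ge> 0\<close>.\<close>
    also have "\<dots> \<le> (\<Sum>\<psi>\<in>X. W \<psi> * V)"
      using GX finX W(1) V by (intro sum_mono2) auto
    finally show "(\<Sum>\<psi>\<in>G. W \<psi> * Re (z * short_sum J a \<psi>)) \<le> T * V"
      by (simp add: T_def sum_distrib_right)
    have "(\<Sum>\<psi>\<in>X - G. W \<psi> * Re (z * short_sum J a \<psi>)) \<le> (\<Sum>\<psi>\<in>X - G. 4 ^ card P * C)"
    proof (rule sum_mono)
      fix \<psi> assume "\<psi> \<in> X - G"
      hence \<psi>: "\<psi> \<in> X" by simp
      have "Re (z * short_sum J a \<psi>) \<le> norm (z * short_sum J a \<psi>)" by (rule complex_Re_le_cmod)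
      also have "\<dots> \<le> C"
        using norm_short_sum_le[OF bm[OF \<psi>] a] by (simp add: norm_mult norm_z C_def)
      finally have "W \<psi> * Re (z * short_sum J a \<psi>) \<le> W \<psi> * C"
        using W(1)[OF \<psi>] by (rule mult_left_mono)
      also have "\<dots> \<le> 4 ^ card P * C" using W(2)[OF \<psi>] C by (rule mult_right_mono)
      finally show "W \<psi> * Re (z * short_sum J a \<psi>) \<le> 4 ^ card P * C" .
    qed
    also have "\<dots> = real (card (X - G)) * (4 ^ card P * C)" by simp
    also have "\<dots> \<le> 2 * (4 ^ card P * C)"
    proof (rule mult_right_mono)
      show "real (card (X - G)) \<le> 2"
        using card_not_good_char[OF q0] unfolding X_def G_def by linarith
    qed (use C in simp)
    finally show "(\<Sum>\<psi>\<in>X - G. W \<psi> * Re (z * short_sum J a \<psi>)) \<le> 2 * (4 ^ card P * C)" .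
  qed
  finally have "cos \<theta> * Re S \<le> T * V + 2 * (4 ^ card P * C)" .
  moreover have "cos \<theta> * (T * ((\<Sum>p\<in>P. truncated_weight J a (p, 1)) / 2)) \<le> cos \<theta> * Re S"
    using Re_S cos by (rule mult_left_mono)
  ultimately have "T * (cos \<theta> * ((\<Sum>p\<in>P. truncated_weight J a (p, 1)) / 2)) \<le> T * V + 2 * (4 ^ card P * C)"
    by (simp only: mult_ac)
  moreover have "T > 0" using T q by simp
  ultimately have "cos \<theta> * ((\<Sum>p\<in>P. truncated_weight J a (p, 1)) / 2) \<le> V + 2 * (4 ^ card P * C) / T"
    by (simp add: field_simps)
  also have "2 * (4 ^ card P * C) / T \<le> 2 * (4 ^ card P * C) / (real q - 1)"
    using T q C by (intro divide_left_mono) auto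
  finally show ?thesis by (simp add: C_def mult_ac)
qed

section \<open>Choice of parameters and conclusion\<close>

lemma exists_primes_subset:
  assumes "y \<ge> 3" "real k * ln y \<le> (y - 3) * ln 2"
  obtains P where "finite P" "card P = k" "\<And>p. p \<in> P \<Longrightarrow> prime p" "\<And>p. p \<in> P \<Longrightarrow> real p \<le> y"
proof -
  have "ln y > 0" using assms(1) by simp
  moreover have "real k * ln y \<le> real (card {p. prime p \<and> real p \<le> y}) * ln y"
    using assms(2) card_primes_lower_bound[OF assms(1)] by linarith
  ultimately have "k \<le> card {p. prime p \<and> real p \<le> y}" by simp
  then obtain P where "P \<subseteq> {p. prime p \<and> real p \<le> y}" "card P = k" "finite P"
    by (rule obtain_subset_with_card_n)
  thus ?thesis using that[of P] by auto
qed

text \<open>If \<open>cos \<theta> = 0\<close>, the strict upper bound for \<open>D\<close> is 0 and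
  no positive \<open>D\<close> exists; hence the premise \<open>cos \<theta> \<noteq> 0\<close>. The
  witnesses are \<open>\<epsilon> = 0\<close> and \<open>D = cos \<theta> * c0\<close>.\<close>

theorem theorem1p3:
  fixes \<sigma> :: real
  assumes "GRH" and "1 / 2 < \<sigma>" and "\<sigma> < 1"
  shows "\<exists>\<epsilon> :: nat \<Rightarrow> real. \<epsilon> \<in> o(\<lambda>_. 1) \<and>
    (\<forall>\<theta> \<in> {0..pi / 2} \<union> {3 * pi / 2..2 * pi}. cos \<theta> \<noteq> 0 \<longrightarrow>
      (\<exists>D>0. \<forall>\<^sub>F q in sequentially. prime q \<longrightarrow>
         D < cos \<theta> * (\<sigma> / (1 - \<sigma>) + \<epsilon> q) * (1 / (2 * \<sigma>)) powr (1 - \<sigma>) \<and>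
         Max ((\<lambda>\<psi>. Re (exp (- \<i> * of_real \<theta>) * log_dirichlet_L q \<psi> (of_real \<sigma>))) `
              {\<psi>. dirichlet_char q \<psi> \<and> \<psi> \<noteq> principal_char q})
           \<ge> D * (ln (real q) powr (1 - \<sigma>) / ln (ln (real q)) powr \<sigma>)))"
proof -
  obtain K \<rho> where K: "0 < K" and \<rho>: "0 < \<rho>" "\<rho> < 1"
    and approx: "\<And>q \<psi> J. q \<ge> 3 \<Longrightarrow> good_char q \<psi> \<Longrightarrow>
       norm (log_dirichlet_L q \<psi> (of_real \<sigma>) - short_sum J (3 - \<sigma>) \<psi>) \<le> K * ln (real q) * \<rho> ^ J"
    using log_dirichlet_L_approx[OF assms] by metis
  define C2 where "C2 = (\<Sum>\<^sub>\<infinity>i\<in>prime_pows. pp_weight 2 i)"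
  \<comment> \<open>The Taylor degree will be about \<open>c * ln (ln q)\<close>. The summand 16
    makes the truncated exponentials accurate at all primes of \<open>P\<close>; the other one makes
    \<open>\<rho> ^ J\<close> at most \<open>1 / ln q\<close>.\<close>
  define c where "c = 16 + 1 / ln (1 / \<rho>)"
  have ln\<rho>: "ln (1 / \<rho>) > 0" using \<rho> by simp
  have c: "c > 16" using ln\<rho> by (simp add: c_def)
  have C2: "C2 \<ge> 0" unfolding C2_def by (intro infsum_nonneg pp_weight_nonneg)
  define F where "F q = ln (real q) powr (1 - \<sigma>) / ln (ln (real q)) powr \<sigma>" for q :: nat
  define Q where "Q = \<sigma> / (1 - \<sigma>) * (1 / (2 * \<sigma>)) powr (1 - \<sigma>)"
  have Q: "Q > 0" using assms by (simp add: Q_def)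
  \<comment> \<open>The average yields the constant \<open>1 / 32\<close>, half of which is kept to
    absorb bounded errors. The bound \<open>Q / 2\<close> keeps \<open>D\<close> strictly below its
    upper limit.\<close>
  define c0 where "c0 = min (1 / 64) (Q / 2)"
  have c0: "0 < c0" "c0 \<le> 1 / 64" "c0 < Q" using Q by (auto simp: c0_def)
  have main: "\<forall>\<^sub>F q in sequentially. prime q \<longrightarrow>
         cos \<theta> * c0 < cos \<theta> * (\<sigma> / (1 - \<sigma>) + 0) * (1 / (2 * \<sigma>)) powr (1 - \<sigma>) \<and>
         Max ((\<lambda>\<psi>. Re (exp (- \<i> * of_real \<theta>) * log_dirichlet_L q \<psi> (of_real \<sigma>))) `
              {\<psi>. dirichlet_char q \<psi> \<and> \<psi> \<noteq> principal_char q})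
           \<ge> cos \<theta> * c0 * F q" if cos: "cos \<theta> > 0" for \<theta>
  proof -
    have "filterlim F at_top sequentially"
      unfolding F_def using assms by real_asymp
    hence ev1: "\<forall>\<^sub>F q in sequentially. F q > 64 * (K + 1) / cos \<theta>"
      by (simp add: filterlim_at_top_dense)
    \<comment> \<open>The third condition lets Chebyshev's bound supply \<open>k\<close> primes up
      to \<open>y\<close>. The fourth makes the Taylor degree large enough for them, with
      \<open>15 / 2 = 3 * (5 / 2)\<close> and \<open>3 - \<sigma> < 5 / 2\<close>.\<close>
    have ev2: "\<forall>\<^sub>F q in sequentially. ln (real q) * ln (ln (real q)) \<ge> 3"
      "\<forall>\<^sub>F q in sequentially. ln (real q) * ln (ln (real q)) < real q"
      "\<forall>\<^sub>F q in sequentially. ln (real q) / 4 * ln (ln (real q) * ln (ln (real q))) \<le>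
          (ln (real q) * ln (ln (real q)) - 3) * (1 / 2)"
      "\<forall>\<^sub>F q in sequentially. 15 / 2 * ln (ln (real q) * ln (ln (real q))) + 1 \<le> 16 * ln (ln (real q))"
      "\<forall>\<^sub>F q in sequentially. ln (real q) \<ge> 8" "\<forall>\<^sub>F q in sequentially. ln (ln (real q)) \<ge> 1"
      by real_asymp+
    \<comment> \<open>The contribution of the excluded characters: the square root of
      \<open>q\<close> times a power of \<open>ln q\<close>, divided by
      \<open>q - 1\<close>.\<close>
    have "(\<lambda>q. 2 * exp (ln (real q) / 2) * (exp (2 * (c * ln (ln (real q)) + 1)) * C2) / (real q - 1)) \<longlonglongrightarrow> 0"
      using c by real_asymp
    hence ev3: "\<forall>\<^sub>F q in sequentially.
        2 * exp (ln (real q) / 2) * (exp (2 * (c * ln (ln (real q)) + 1)) * C2) / (real q - 1) < 1"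
      by (rule order_tendstoD) simp
    show ?thesis
      using ev1 ev2 ev3
    proof eventually_elim
      case (elim q)
      show ?case
      proof (intro impI conjI)
        show "cos \<theta> * c0 < cos \<theta> * (\<sigma> / (1 - \<sigma>) + 0) * (1 / (2 * \<sigma>)) powr (1 - \<sigma>)"
          using mult_strict_left_mono[OF c0(3) cos] by (simp add: Q_def mult.assoc)
        assume q: "prime q"
        define L M where "L = ln (real q)" and "M = ln L"
        note elim' = elim[folded L_def, folded M_def]
        \<comment> \<open>About \<open>L / 4\<close> primes up to \<open>y\<close> are used: few
          enough that \<open>4 ^ k\<close> is at most the square root of \<open>q\<close>, and small
          enough primes that \<open>k * y powr (- \<sigma>)\<close> has the order of
          \<open>F q\<close>.\<close>
        define y where "y = L * M"
        define k where "k = nat \<lfloor>L / 4\<rfloor>"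
        define J where "J = nat \<lceil>c * M\<rceil>"
        have L: "L \<ge> 8" and M: "M \<ge> 1" and y: "y \<ge> 3" "y < real q"
          using elim' by (auto simp: y_def)
        have q3: "q \<ge> 3" using y by linarith
        have k: "real k \<le> L / 4" "L / 8 \<le> real k"
        proof -
          show "real k \<le> L / 4" unfolding k_def using L by (intro of_nat_floor) simp
          have "L / 4 < real k + 1" unfolding k_def by linarith
          thus "L / 8 \<le> real k" using L by linarith
        qed
        have J: "c * M \<le> real J" "real J \<le> c * M + 1"
        proof -
          show "c * M \<le> real J" unfolding J_def by linarith
          have "c * M \<ge> 0" using c M by simp
          thus "real J \<le> c * M + 1" unfolding J_def by linarith
        qed
        have "real k * ln y \<le> L / 4 * ln y"
          using k(1) y(1) by (intro mult_right_mono) auto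
        also have "\<dots> \<le> (y - 3) * (1 / 2)" using elim'(4) by (simp add: y_def)
        also have "\<dots> \<le> (y - 3) * ln 2"
          using y(1) ln2_ge_two_thirds by (intro mult_left_mono) auto
        finally have "real k * ln y \<le> (y - 3) * ln 2" .
        then obtain P where P: "finite P" "card P = k" "\<And>p. p \<in> P \<Longrightarrow> prime p" "\<And>p. p \<in> P \<Longrightarrow> real p \<le> y"
          using exists_primes_subset y(1) by metis
        have coprime: "coprime p q" if "p \<in> P" for p
          using P(3,4)[OF that] y(2) q by (intro primes_coprime) auto
        let ?g = "\<lambda>\<psi>. Re (exp (- \<i> * of_real \<theta>) * log_dirichlet_L q \<psi> (of_real \<sigma>))"
        let ?X = "{\<psi>. dirichlet_char q \<psi> \<and> \<psi> \<noteq> principal_char q}"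
        have finX: "finite ?X"
          using finite_subset[OF _ finite_dirichlet_chars[of q]] q3 by fastforce

        have "L * \<rho> ^ J \<le> 1"
        proof -
          have "1 \<le> c * ln (1 / \<rho>)" using ln\<rho> by (simp add: c_def distrib_right)
          hence "M \<le> c * M * ln (1 / \<rho>)" using mult_right_mono[of 1 "c * ln (1 / \<rho>)" M] M by (simp add: mult_ac)
          also have "\<dots> \<le> real J * ln (1 / \<rho>)" using J(1) ln\<rho> by (intro mult_right_mono) auto
          finally have "exp M \<le> exp (real J * ln (1 / \<rho>))" by simp
          moreover have "exp M = L" using L by (simp add: M_def)
          moreover have "exp (real J * ln (1 / \<rho>)) = 1 / \<rho> ^ J"
            using \<rho> by (simp add: exp_of_nat_mult power_divide)
          ultimately show ?thesis using \<rho> by (simp add: field_simps)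
        qed
        hence err: "K * L * \<rho> ^ J \<le> K" using K mult_left_mono[of "L * \<rho> ^ J" 1 K] by (simp add: mult_ac)

        have small: "2 * 4 ^ card P * (3 ^ J * C2) / (real q - 1) \<le> 1"
        proof -
          have ln_le: "ln (4::real) \<le> 2" "ln (3::real) \<le> 2"
          proof -
            show "ln (4::real) \<le> 2" using ln_realpow[of 2 2] ln_2_less_1 by simp
            moreover have "ln (3::real) \<le> ln 4" by simp
            ultimately show "ln (3::real) \<le> 2" by linarith
          qed
          have "(4::real) ^ k = exp (real k * ln 4)" by (simp add: exp_of_nat_mult)
          also have "\<dots> \<le> exp (L / 2)"
            using mult_mono[OF k(1) ln_le(1)] L by simp
          finally have 4: "(4::real) ^ k \<le> exp (L / 2)" .
          have "(3::real) ^ J = exp (real J * ln 3)" by (simp add: exp_of_nat_mult)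
          also have "\<dots> \<le> exp ((c * M + 1) * 2)"
            using mult_mono[OF J(2) ln_le(2)] c M by simp
          finally have 3: "(3::real) ^ J \<le> exp (2 * (c * M + 1))" by (simp only: mult.commute)
          have "2 * 4 ^ card P * (3 ^ J * C2) / (real q - 1) \<le>
                  2 * exp (L / 2) * (exp (2 * (c * M + 1)) * C2) / (real q - 1)"
            unfolding P(2) using 3 4 C2 q3 by (intro divide_right_mono mult_mono) auto
          thus ?thesis using elim'(8) by linarith
        qed

        have "F q / 16 \<le> (\<Sum>p\<in>P. truncated_weight J (3 - \<sigma>) (p, 1))"
        proof -
          \<comment> \<open>At least \<open>L / 8\<close> primes contribute
            \<open>y powr (- \<sigma>) / 2\<close> each, where \<open>y = L * M\<close>.\<close>
          have "F q / 16 = L / 8 * (y powr (-\<sigma>) / 2)"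
            using L M by (simp add: F_def L_def[symmetric] M_def[symmetric] y_def powr_mult powr_diff powr_minus field_simps)
          also have "\<dots> \<le> real k * (y powr (-\<sigma>) / 2)"
            using k(2) by (intro mult_right_mono) auto
          also have "\<dots> = (\<Sum>p\<in>P. y powr (-\<sigma>) / 2)" using P(2) by simp
          also have "\<dots> \<le> (\<Sum>p\<in>P. truncated_weight J (3 - \<sigma>) (p, 1))"
          proof (rule sum_mono)
            fix p assume p: "p \<in> P"
            have p0: "real p > 1" using P(3)[OF p] prime_gt_1_nat by simp
            have "y powr (-\<sigma>) \<le> real p powr (-\<sigma>)"
              using p0 P(4)[OF p] assms by (intro powr_mono2') auto
            moreover have "real p powr (3 - \<sigma> - 3) / 2 \<le> truncated_weight J (3 - \<sigma>) (p, 1)"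
            proof (rule truncated_weight_prime_ge[OF P(3)[OF p]])
              have "3 * ((3 - \<sigma>) * ln p) \<le> 3 * (5 / 2 * ln y)"
                using p0 P(4)[OF p] y(1) assms by (intro mult_left_mono mult_mono) auto
              moreover have "15 / 2 * ln y + 1 \<le> 16 * M" using elim'(5) by (simp only: y_def)
              ultimately have "3 * ((3 - \<sigma>) * ln p) + 1 \<le> 16 * M" by linarith
              also have "\<dots> \<le> c * M" using c M by (intro mult_right_mono) auto
              also have "\<dots> \<le> real J" by (rule J(1))
              finally show "3 * ((3 - \<sigma>) * ln p) + 1 \<le> real J" .
            qed (use assms in auto)
            ultimately show "y powr (-\<sigma>) / 2 \<le> truncated_weight J (3 - \<sigma>) (p, 1)" by simp
          qed
          finally show ?thesis .
        qed
        hence lower: "cos \<theta> * (F q / 32) \<le> cos \<theta> * ((\<Sum>p\<in>P. truncated_weight J (3 - \<sigma>) (p, 1)) / 2)"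
          using cos by (intro mult_left_mono) auto

        \<comment> \<open>Otherwise the resonance inequality with
          \<open>V = cos \<theta> * c0 * F q + K\<close> gives \<open>cos \<theta> * F q / 32 \<le>
          cos \<theta> * F q / 64 + K + 1\<close>, against the choice of \<open>q\<close> with
          \<open>F q > 64 * (K + 1) / cos \<theta>\<close>.\<close>
        show "Max (?g ` ?X) \<ge> cos \<theta> * c0 * F q"
        proof (rule ccontr)
          assume "\<not> Max (?g ` ?X) \<ge> cos \<theta> * c0 * F q"
          hence less: "?g \<psi> < cos \<theta> * c0 * F q" if "\<psi> \<in> ?X" for \<psi>
            using Max_ge[of "?g ` ?X" "?g \<psi>"] finX that by fastforce
          have Fpos: "F q > 0" using elim'(1) K cos by (smt (verit) divide_pos_pos)
          have "cos \<theta> * ((\<Sum>p\<in>P. truncated_weight J (3 - \<sigma>) (p, 1)) / 2) \<le>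
                  (cos \<theta> * c0 * F q + K) + 2 * 4 ^ card P * (3 ^ J * C2) / (real q - 1)"
            unfolding C2_def
          proof (rule resonance_inequality[OF q _ P(1,3) coprime])
            show "cos \<theta> * c0 * F q + K \<ge> 0" using cos c0 Fpos K by (intro add_nonneg_nonneg mult_nonneg_nonneg) auto
            fix \<psi> assume good: "good_char q \<psi>"
            let ?e = "log_dirichlet_L q \<psi> (of_real \<sigma>) - short_sum J (3 - \<sigma>) \<psi>"
            have "Re (exp (- \<i> * of_real \<theta>) * short_sum J (3 - \<sigma>) \<psi>) = ?g \<psi> - Re (exp (- \<i> * of_real \<theta>) * ?e)"
              by (simp only: right_diff_distrib minus_complex.sel)
            moreover have "\<bar>Re (exp (- \<i> * of_real \<theta>) * ?e)\<bar> \<le> norm ?e"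
              using abs_Re_le_cmod[of "exp (- \<i> * of_real \<theta>) * ?e"] by (simp add: norm_mult)
            moreover have "norm ?e \<le> K"
              using approx[OF q3 good, of J] err by (simp add: L_def)
            moreover have "?g \<psi> < cos \<theta> * c0 * F q"
              using less[of \<psi>] good by (simp add: good_char_def)
            ultimately show "Re (exp (- \<i> * of_real \<theta>) * short_sum J (3 - \<sigma>) \<psi>) \<le> cos \<theta> * c0 * F q + K"
              by linarith
          qed (use q3 assms cos in auto)
          hence "cos \<theta> * (F q / 32) \<le> cos \<theta> * c0 * F q + K + 1" using lower small by linarith
          also have "cos \<theta> * c0 * F q \<le> cos \<theta> * (1 / 64) * F q"
            using cos c0 Fpos by (intro mult_right_mono mult_left_mono) auto
          finally have "cos \<theta> * F q \<le> 64 * (K + 1)" by (simp add: mult.commute)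
          hence "F q \<le> 64 * (K + 1) / cos \<theta>" using cos by (simp add: pos_le_divide_eq mult.commute)
          thus False using elim'(1) by linarith
        qed
      qed
    qed
  qed
  have "cos \<theta> \<ge> 0" if "\<theta> \<in> {0..pi / 2} \<union> {3 * pi / 2..2 * pi}" for \<theta>
  proof (cases "\<theta> \<le> pi / 2")
    case True
    thus ?thesis using that pi_gt_zero by (intro cos_ge_zero) auto
  next
    case False
    hence "cos (\<theta> - 2 * pi) \<ge> 0" using that by (intro cos_ge_zero) auto
    thus ?thesis by (simp add: cos_diff)
  qed
  note cos_nonneg = this
  show ?thesis
  proof (intro exI[of _ "\<lambda>_. 0 :: real"] conjI ballI impI)
    fix \<theta> assume "\<theta> \<in> {0..pi / 2} \<union> {3 * pi / 2..2 * pi}" "cos \<theta> \<noteq> 0"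
    hence cos: "cos \<theta> > 0" using cos_nonneg[of \<theta>] by linarith
    show "\<exists>D>0. \<forall>\<^sub>F q in sequentially. prime q \<longrightarrow>
         D < cos \<theta> * (\<sigma> / (1 - \<sigma>) + 0) * (1 / (2 * \<sigma>)) powr (1 - \<sigma>) \<and>
         Max ((\<lambda>\<psi>. Re (exp (- \<i> * of_real \<theta>) * log_dirichlet_L q \<psi> (of_real \<sigma>))) `
              {\<psi>. dirichlet_char q \<psi> \<and> \<psi> \<noteq> principal_char q})
           \<ge> D * (ln (real q) powr (1 - \<sigma>) / ln (ln (real q)) powr \<sigma>)"
      using main[OF cos] cos c0(1) unfolding F_def by (intro exI[of _ "cos \<theta> * c0"] conjI) auto
  qed simp
qed

end
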